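(* Let $p,q\ge1$ and let $\Sigma\subset\mathbb{Z}^N$ be simply connected. Let $f:\Sigma\to\mathcal{Z}$ be an applicable Legendre map and $s^+<f$ an isothermic net. Let $\hat{s}^+$ be a Darboux transform of $s^+$ with parameter $m\in\mathbb{R}^\times$ (distinct from the edge-labels of $s^+$) and set $\hat{f}:=\hat{s}^+\oplus(f\cap(\hat{s}^+)^\perp)$. Then $\hat{f}:\Sigma\to\mathcal{Z}$ is a Darboux transform of $f$ with parameter $m$, and all Darboux transforms of $f$ with parameter $m$ arise this way.
   Context: Domain: an edge $ij$ of $\Sigma\subset\mathbb{Z}^N$ is a pair of points of $\Sigma$ differing by a standard unit vector; a quadrilateral is an elementary square with all four vertices $i,j,k,\ell$ (in cyclic order) in $\Sigma$. $\Sigma$ is simply connected if any two points are joined by an edge-path in $\Sigma$ and any two edge-paths in $\Sigma$ with the same end-points are related by finitely many moves: (a) replace $i$ by $(iji)$ or conversely, $ij$ an edge; (b) replace $(k\ell i)$ by $(kji)$ on a quadrilateral. A vector-valued $1$-form $\alpha$ assigns $\alpha_{ji}=-\alpha_{ij}$ to each oriented edge from $i$ to $j$; it is closed if $\alpha_{i\ell}+\alpha_{\ell k}+\alpha_{kj}+\alpha_{ji}=0$ on every quadrilateral. For a function $\tau$, $\mathrm{d}\tau_{ji}=\tau_j-\tau_i$. $\mathbb{R}^{p+1,q+1}$ has a non-degenerate symmetric bilinear form $(\cdot,\cdot)$ of signature $(p+1,q+1)$, light cone $\mathcal{L}$ and quadric $\mathcal{Q}=\mathbb{P}(\mathcal{L})$;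 $\mathcal{Z}$ is the set of totally null $2$-planes in $\mathbb{R}^{p+1,q+1}$. Isothermic nets: a map $s:\Sigma\to\mathcal{Q}$ (null line subbundle) is regular if on each quadrilateral $s_i,s_j,s_k,s_\ell$ are pairwise distinct, $\dim(s_i+s_j+s_k+s_\ell)\ge3$, and $s_i\not\perp s_k$, $s_j\not\perp s_\ell$. An isothermic net $(s,\eta)$ is a regular $s$ with a closed, never-zero $\Lambda^2\mathbb{R}^{p+1,q+1}$-valued $1$-form $\eta$ with $\eta_{ji}\in s_j\wedge s_i$ on each edge. A Moutard lift is a never-zero section $\mu$ of $s$ with $\eta_{ji}=\mu_j\wedge\mu_i$; the edge-labelling is $m_{ij}=1/(\mu_i,\mu_j)\in\mathbb{R}^\times\cup\{\infty\}$. All this applies also to nets on $\{0,1\}\times\Sigma\subset\mathbb{Z}^{N+1}$. Given nets $u,v$ on a domain $D$, $u\sqcup v:\{0,1\}\times D\to\mathcal{Q}$ equals $u$ on $\{0\}\times D$ and $v$ on $\{1\}\times D$. Isothermic nets $(u,\eta^u),(v,\eta^v)$ on $D$ are a Darboux pair with parameter $m\in\mathbb{R}^\times\cup\{\infty\}$ ($v$ is a Darboux transform of $u$ with parameter $m$) if $u\sqcup v$ is isothermic with a $1$-form restricting to $\eta^u$ and $\eta^v$ on the two copies of $D$ and the edge-label of every vertical edge $\{0,1\}\times\{i\}$ is $m$. It is isotropic if $m=\infty$ (so $u_i\perp v_i$). Legendre maps: $f:\Sigma\to\mathcal{Z}$ with $f_i\cap f_j\ne\{0\}$ on each edge. Regular: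 (i) on each edge $f_{ij}:=f_i+f_j$ is $3$-dimensional, so $s_{ij}:=f_i\cap f_j$ is $1$-dimensional; (ii) on each quadrilateral $s_{ij}\wedge s_{jk}\wedge s_{k\ell}\wedge s_{\ell i}\ne\{0\}$. A regular $f$ is applicable if there is a closed $\Lambda^2\mathbb{R}^{p+1,q+1}$-valued $1$-form $\eta$ with $\eta_{ij}\in\Lambda^2f_{ij}$ and $\eta_{ij}\wedge s_{ij}\ne\{0\}$ on each edge; $\eta$ is considered up to adding $\mathrm{d}\tau$, $\tau$ a section of $\Lambda^2f$, with class $[\eta]$, and isothermic nets $(s,\eta^s)$ with $s<f$ are those with $\eta^s\in[\eta]$. Regularity is a standing assumption on all nets and Legendre maps considered, including transforms. Darboux transform of an applicable Legendre map $f$ with parameter $m\in\mathbb{R}^\times$: any $\hat f=\hat s^+\oplus\hat s^-$ where $f=s^+\oplus s^-$ for an isotropic Darboux pair $s^\pm$ of isothermic nets, $m$ is distinct from all edge-labels of $s=s^+\sqcup s^-$, and $\hat s=\hat s^+\sqcup\hat s^-$ is a Darboux transform of $s$ with parameter $m$.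
   Formalization: In the first claim the edge-labels of s⁺ are also assumed to be finite (∞ is not a label): if ∞ is a label on an edge ij, f_i+f_j is totally null, f contains no regular isotropic Darboux pair, and f has no Darboux transforms, so the claim as stated fails. *)

theory Defs
  imports "HOL-Analysis.Analysis"
begin

section \<open>Domains in the integer lattice\<close>

text \<open>Points of $\mathbb{Z}^N$ are integer lists of length $N$, so that
  $\{0,1\}\times\Sigma\subset\mathbb{Z}^{N+1}$ is obtained by consing a coordinate.\<close>

definition lattice :: "nat \<Rightarrow> int list set" where
  "lattice N = {i. length i = N}"

definition edge :: "int list set \<Rightarrow> int list \<Rightarrow> int list \<Rightarrow> bool" where
  "edge \<Sigma> i j \<longleftrightarrow> i \<in> \<Sigma> \<and> j \<in> \<Sigma> \<and>
     (\<exists>a<length i. \<exists>\<epsilon>\<in>{1, -1}. j = i[a := i ! a + \<epsilon>])"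

text \<open>The signs let every vertex of a square play the role of \<open>i\<close>, in either cyclic order.\<close>

definition quad :: "int list set \<Rightarrow> int list \<Rightarrow> int list \<Rightarrow> int list \<Rightarrow> int list \<Rightarrow> bool" where
  "quad \<Sigma> i j k l \<longleftrightarrow> i \<in> \<Sigma> \<and> j \<in> \<Sigma> \<and> k \<in> \<Sigma> \<and> l \<in> \<Sigma> \<and>
     (\<exists>a<length i. \<exists>b<length i. a \<noteq> b \<and>
        (\<exists>\<epsilon>\<in>{1, -1}. \<exists>\<delta>\<in>{1, -1}.
           j = i[a := i ! a + \<epsilon>] \<and>
           l = i[b := i ! b + \<delta>] \<and>
           k = i[a := i ! a + \<epsilon>, b := i ! b + \<delta>]))"

definition edge_path :: "int list set \<Rightarrow> int list list \<Rightarrow> bool" where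
  "edge_path \<Sigma> P \<longleftrightarrow> P \<noteq> [] \<and> set P \<subseteq> \<Sigma> \<and> successively (edge \<Sigma>) P"

inductive path_move :: "int list set \<Rightarrow> int list list \<Rightarrow> int list list \<Rightarrow> bool"
  for \<Sigma> where
  backtrack: "edge \<Sigma> i j \<Longrightarrow> path_move \<Sigma> (P @ [i] @ Q) (P @ [i, j, i] @ Q)"
| flip: "quad \<Sigma> i j k l \<Longrightarrow> path_move \<Sigma> (P @ [k, l, i] @ Q) (P @ [k, j, i] @ Q)"

definition simply_connected_domain :: "int list set \<Rightarrow> bool" where
  "simply_connected_domain \<Sigma> \<longleftrightarrow>
     (\<forall>i\<in>\<Sigma>. \<forall>j\<in>\<Sigma>. \<exists>P. edge_path \<Sigma> P \<and> hd P = i \<and> last P = j) \<and>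
     (\<forall>P Q. edge_path \<Sigma> P \<and> edge_path \<Sigma> Q \<and> hd P = hd Q \<and> last P = last Q
        \<longrightarrow> equivclp (path_move \<Sigma>) P Q)"

definition cyl :: "int list set \<Rightarrow> int list set" where
  "cyl D = {b # i | b i. b \<in> {0, 1} \<and> i \<in> D}"

definition join :: "(int list \<Rightarrow> 'b) \<Rightarrow> (int list \<Rightarrow> 'b) \<Rightarrow> int list \<Rightarrow> 'b"
    (infixr "\<squnion>\<^sub>n" 65) where
  "(u \<squnion>\<^sub>n v) x = (if hd x = 0 then u (tl x) else v (tl x))"


section \<open>Exterior products\<close>

text \<open>Multivectors are represented by their antisymmetric component arrays.\<close>

definition wedge :: "real^'n \<Rightarrow> real^'n \<Rightarrow> real^'n^'n" where
  "wedge u v = (\<chi> a b. u $ a * v $ b - u $ b * v $ a)"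

definition wedge21 :: "real^'n^'n \<Rightarrow> real^'n \<Rightarrow> real^'n^'n^'n" where
  "wedge21 \<omega> v = (\<chi> a b c. \<omega> $ a $ b * v $ c + \<omega> $ b $ c * v $ a + \<omega> $ c $ a * v $ b)"

definition wedge22 :: "real^'n^'n \<Rightarrow> real^'n^'n \<Rightarrow> real^'n^'n^'n^'n" where
  "wedge22 \<omega> \<theta> = (\<chi> a b c d.
       \<omega> $ a $ b * \<theta> $ c $ d - \<omega> $ a $ c * \<theta> $ b $ d + \<omega> $ a $ d * \<theta> $ b $ c
     + \<omega> $ b $ c * \<theta> $ a $ d - \<omega> $ b $ d * \<theta> $ a $ c + \<omega> $ c $ d * \<theta> $ a $ b)"

definition wedge_space :: "(real^'n) set \<Rightarrow> (real^'n) set \<Rightarrow> (real^'n^'n) set" where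
  "wedge_space U W = span {wedge u w | u w. u \<in> U \<and> w \<in> W}"

abbreviation Lambda2 :: "(real^'n) set \<Rightarrow> (real^'n^'n) set" where
  "Lambda2 U \<equiv> wedge_space U U"

text \<open>A 1-form is a function with \<open>\<alpha> j i\<close> the value on the oriented edge from \<open>i\<close> to \<open>j\<close>;
  its values on pairs that are not edges are irrelevant.\<close>

definition closed_form :: "int list set \<Rightarrow> (int list \<Rightarrow> int list \<Rightarrow> 'v::real_vector) \<Rightarrow> bool" where
  "closed_form \<Sigma> \<alpha> \<longleftrightarrow>
     (\<forall>i j. edge \<Sigma> i j \<longrightarrow> \<alpha> j i = - \<alpha> i j) \<and>
     (\<forall>i j k l. quad \<Sigma> i j k l \<longrightarrow> \<alpha> i l + \<alpha> l k + \<alpha> k j + \<alpha> j i = 0)"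


section \<open>Pseudo-Euclidean space\<close>

text \<open>The orthogonal decomposition makes \<open>B\<close> non-degenerate and forces
  \<open>CARD('n) = a + b\<close>.\<close>

definition has_signature :: "(real^'n \<Rightarrow> real^'n \<Rightarrow> real) \<Rightarrow> nat \<Rightarrow> nat \<Rightarrow> bool" where
  "has_signature B a b \<longleftrightarrow> bilinear B \<and> (\<forall>x y. B x y = B y x) \<and>
     (\<exists>P M. subspace P \<and> subspace M \<and> dim P = a \<and> dim M = b \<and>
        span (P \<union> M) = UNIV \<and> (\<forall>x\<in>P. \<forall>y\<in>M. B x y = 0) \<and>
        (\<forall>x\<in>P. x \<noteq> 0 \<longrightarrow> B x x > 0) \<and> (\<forall>x\<in>M. x \<noteq> 0 \<longrightarrow> B x x < 0))"

definition perp :: "(real^'n \<Rightarrow> real^'n \<Rightarrow> real) \<Rightarrow> (real^'n) set \<Rightarrow> (real^'n) set" where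
  "perp B U = {y. \<forall>x\<in>U. B x y = 0}"

definition quadric :: "(real^'n \<Rightarrow> real^'n \<Rightarrow> real) \<Rightarrow> (real^'n) set set" where
  "quadric B = {L. subspace L \<and> dim L = 1 \<and> (\<forall>x\<in>L. B x x = 0)}"

definition null_planes :: "(real^'n \<Rightarrow> real^'n \<Rightarrow> real) \<Rightarrow> (real^'n) set set" where
  "null_planes B = {P. subspace P \<and> dim P = 2 \<and> (\<forall>x\<in>P. \<forall>y\<in>P. B x y = 0)}"

definition direct_sum :: "(real^'n) set \<Rightarrow> (real^'n) set \<Rightarrow> (real^'n) set \<Rightarrow> bool" where
  "direct_sum F U W \<longleftrightarrow> F = span (U \<union> W) \<and> U \<inter> W = {0}"


section \<open>Isothermic nets\<close>

definition regular_net ::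
  "(real^'n \<Rightarrow> real^'n \<Rightarrow> real) \<Rightarrow> int list set \<Rightarrow> (int list \<Rightarrow> (real^'n) set) \<Rightarrow> bool" where
  "regular_net B \<Sigma> s \<longleftrightarrow> (\<forall>i\<in>\<Sigma>. s i \<in> quadric B) \<and>
     (\<forall>i j k l. quad \<Sigma> i j k l \<longrightarrow>
        distinct [s i, s j, s k, s l] \<and>
        dim (span (s i \<union> s j \<union> s k \<union> s l)) \<ge> 3 \<and>
        \<not> s k \<subseteq> perp B (s i) \<and> \<not> s l \<subseteq> perp B (s j))"

definition isothermic ::
  "(real^'n \<Rightarrow> real^'n \<Rightarrow> real) \<Rightarrow> int list set \<Rightarrow> (int list \<Rightarrow> (real^'n) set)
    \<Rightarrow> (int list \<Rightarrow> int list \<Rightarrow> real^'n^'n) \<Rightarrow> bool" where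
  "isothermic B \<Sigma> s \<eta> \<longleftrightarrow> regular_net B \<Sigma> s \<and> closed_form \<Sigma> \<eta> \<and>
     (\<forall>i j. edge \<Sigma> i j \<longrightarrow> \<eta> j i \<noteq> 0 \<and> \<eta> j i \<in> wedge_space (s j) (s i))"

definition moutard_lift ::
  "int list set \<Rightarrow> (int list \<Rightarrow> (real^'n) set) \<Rightarrow> (int list \<Rightarrow> int list \<Rightarrow> real^'n^'n)
    \<Rightarrow> (int list \<Rightarrow> real^'n) \<Rightarrow> bool" where
  "moutard_lift \<Sigma> s \<eta> \<mu> \<longleftrightarrow> (\<forall>i\<in>\<Sigma>. \<mu> i \<in> s i \<and> \<mu> i \<noteq> 0) \<and>
     (\<forall>i j. edge \<Sigma> i j \<longrightarrow> \<eta> j i = wedge (\<mu> j) (\<mu> i))"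

text \<open>Edge-labels live in $\mathbb{R}^\times\cup\{\infty\}$, here inside \<^typ>\<open>ereal\<close>, where
  \<open>1 / 0 = \<infinity>\<close>; the values \<open>0\<close> and \<open>-\<infinity>\<close> do not occur. The label does not depend on the
  Moutard lift, so this is a functional relation.\<close>

definition edge_label ::
  "(real^'n \<Rightarrow> real^'n \<Rightarrow> real) \<Rightarrow> int list set \<Rightarrow> (int list \<Rightarrow> (real^'n) set)
    \<Rightarrow> (int list \<Rightarrow> int list \<Rightarrow> real^'n^'n) \<Rightarrow> int list \<Rightarrow> int list \<Rightarrow> ereal \<Rightarrow> bool" where
  "edge_label B \<Sigma> s \<eta> i j m \<longleftrightarrow> edge \<Sigma> i j \<and>
     (\<exists>\<mu>. moutard_lift \<Sigma> s \<eta> \<mu> \<and> m = 1 / ereal (B (\<mu> i) (\<mu> j)))"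

definition not_edge_label ::
  "(real^'n \<Rightarrow> real^'n \<Rightarrow> real) \<Rightarrow> int list set \<Rightarrow> (int list \<Rightarrow> (real^'n) set)
    \<Rightarrow> (int list \<Rightarrow> int list \<Rightarrow> real^'n^'n) \<Rightarrow> ereal \<Rightarrow> bool" where
  "not_edge_label B \<Sigma> s \<eta> m \<longleftrightarrow> (\<forall>i j. \<not> edge_label B \<Sigma> s \<eta> i j m)"

text \<open>The last argument is the 1-form on the cylinder; it is recorded because Darboux
  transforms of \<open>u \<squnion>\<^sub>n v\<close> itself depend on it.\<close>

definition darboux_pair_with ::
  "(real^'n \<Rightarrow> real^'n \<Rightarrow> real) \<Rightarrow> int list set
    \<Rightarrow> (int list \<Rightarrow> (real^'n) set) \<Rightarrow> (int list \<Rightarrow> int list \<Rightarrow> real^'n^'n)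
    \<Rightarrow> (int list \<Rightarrow> (real^'n) set) \<Rightarrow> (int list \<Rightarrow> int list \<Rightarrow> real^'n^'n)
    \<Rightarrow> ereal \<Rightarrow> (int list \<Rightarrow> int list \<Rightarrow> real^'n^'n) \<Rightarrow> bool" where
  "darboux_pair_with B D u \<eta>u v \<eta>v m \<eta> \<longleftrightarrow>
     isothermic B D u \<eta>u \<and> isothermic B D v \<eta>v \<and>
     isothermic B (cyl D) (u \<squnion>\<^sub>n v) \<eta> \<and>
     (\<forall>i j. edge D i j \<longrightarrow> \<eta> (0 # j) (0 # i) = \<eta>u j i \<and> \<eta> (1 # j) (1 # i) = \<eta>v j i) \<and>
     (\<forall>i\<in>D. edge_label B (cyl D) (u \<squnion>\<^sub>n v) \<eta> (0 # i) (1 # i) m)"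

definition darboux_pair ::
  "(real^'n \<Rightarrow> real^'n \<Rightarrow> real) \<Rightarrow> int list set
    \<Rightarrow> (int list \<Rightarrow> (real^'n) set) \<Rightarrow> (int list \<Rightarrow> int list \<Rightarrow> real^'n^'n)
    \<Rightarrow> (int list \<Rightarrow> (real^'n) set) \<Rightarrow> (int list \<Rightarrow> int list \<Rightarrow> real^'n^'n)
    \<Rightarrow> ereal \<Rightarrow> bool" where
  "darboux_pair B D u \<eta>u v \<eta>v m \<longleftrightarrow> (\<exists>\<eta>. darboux_pair_with B D u \<eta>u v \<eta>v m \<eta>)"


section \<open>Applicable Legendre maps\<close>

definition legendre_map ::
  "(real^'n \<Rightarrow> real^'n \<Rightarrow> real) \<Rightarrow> int list set \<Rightarrow> (int list \<Rightarrow> (real^'n) set) \<Rightarrow> bool" where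
  "legendre_map B \<Sigma> f \<longleftrightarrow> (\<forall>i\<in>\<Sigma>. f i \<in> null_planes B) \<and>
     (\<forall>i j. edge \<Sigma> i j \<longrightarrow> f i \<inter> f j \<noteq> {0})"

definition legendre_regular :: "int list set \<Rightarrow> (int list \<Rightarrow> (real^'n) set) \<Rightarrow> bool" where
  "legendre_regular \<Sigma> f \<longleftrightarrow>
     (\<forall>i j. edge \<Sigma> i j \<longrightarrow> dim (span (f i \<union> f j)) = 3) \<and>
     (\<forall>i j k l. quad \<Sigma> i j k l \<longrightarrow>
        {wedge22 (wedge t u) (wedge v w) | t u v w.
           t \<in> f i \<inter> f j \<and> u \<in> f j \<inter> f k \<and> v \<in> f k \<inter> f l \<and> w \<in> f l \<inter> f i} \<noteq> {0})"

text \<open>An applicable Legendre map comes with a class of 1-forms; \<open>\<eta>\<close> is a representative.\<close>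

definition applicable ::
  "(real^'n \<Rightarrow> real^'n \<Rightarrow> real) \<Rightarrow> int list set \<Rightarrow> (int list \<Rightarrow> (real^'n) set)
    \<Rightarrow> (int list \<Rightarrow> int list \<Rightarrow> real^'n^'n) \<Rightarrow> bool" where
  "applicable B \<Sigma> f \<eta> \<longleftrightarrow> legendre_map B \<Sigma> f \<and> legendre_regular \<Sigma> f \<and>
     closed_form \<Sigma> \<eta> \<and>
     (\<forall>i j. edge \<Sigma> i j \<longrightarrow> \<eta> i j \<in> Lambda2 (span (f i \<union> f j)) \<and>
        {wedge21 (\<eta> i j) v | v. v \<in> f i \<inter> f j} \<noteq> {0})"

definition in_class ::
  "int list set \<Rightarrow> (int list \<Rightarrow> (real^'n) set) \<Rightarrow> (int list \<Rightarrow> int list \<Rightarrow> real^'n^'n)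
    \<Rightarrow> (int list \<Rightarrow> int list \<Rightarrow> real^'n^'n) \<Rightarrow> bool" where
  "in_class \<Sigma> f \<eta> \<eta>' \<longleftrightarrow> (\<exists>\<tau>. (\<forall>i\<in>\<Sigma>. \<tau> i \<in> Lambda2 (f i)) \<and>
     (\<forall>i j. edge \<Sigma> i j \<longrightarrow> \<eta>' j i = \<eta> j i + (\<tau> j - \<tau> i)))"

definition isothermic_in ::
  "(real^'n \<Rightarrow> real^'n \<Rightarrow> real) \<Rightarrow> int list set \<Rightarrow> (int list \<Rightarrow> (real^'n) set)
    \<Rightarrow> (int list \<Rightarrow> int list \<Rightarrow> real^'n^'n)
    \<Rightarrow> (int list \<Rightarrow> (real^'n) set) \<Rightarrow> (int list \<Rightarrow> int list \<Rightarrow> real^'n^'n) \<Rightarrow> bool" where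
  "isothermic_in B \<Sigma> f \<eta> s \<eta>s \<longleftrightarrow>
     isothermic B \<Sigma> s \<eta>s \<and> (\<forall>i\<in>\<Sigma>. s i \<subseteq> f i) \<and> in_class \<Sigma> f \<eta> \<eta>s"

text \<open>The two factors of \<open>cyl (cyl \<Sigma>)\<close> are ordered so that the outer coordinate passes from
  \<open>f\<close> to its transform and the inner one from \<open>s\<^sup>+\<close> to \<open>s\<^sup>-\<close>.\<close>

definition legendre_darboux ::
  "(real^'n \<Rightarrow> real^'n \<Rightarrow> real) \<Rightarrow> int list set \<Rightarrow> (int list \<Rightarrow> (real^'n) set)
    \<Rightarrow> (int list \<Rightarrow> int list \<Rightarrow> real^'n^'n) \<Rightarrow> real \<Rightarrow> (int list \<Rightarrow> (real^'n) set) \<Rightarrow> bool" where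
  "legendre_darboux B \<Sigma> f \<eta> m g \<longleftrightarrow> m \<noteq> 0 \<and> legendre_map B \<Sigma> g \<and> legendre_regular \<Sigma> g \<and>
     (\<exists>sp \<eta>p sm \<eta>m \<eta>s tp tm \<eta>t.
        isothermic_in B \<Sigma> f \<eta> sp \<eta>p \<and> isothermic_in B \<Sigma> f \<eta> sm \<eta>m \<and>
        (\<forall>i\<in>\<Sigma>. direct_sum (f i) (sp i) (sm i)) \<and>
        darboux_pair_with B \<Sigma> sp \<eta>p sm \<eta>m \<infinity> \<eta>s \<and>
        not_edge_label B (cyl \<Sigma>) (sp \<squnion>\<^sub>n sm) \<eta>s (ereal m) \<and>
        darboux_pair B (cyl \<Sigma>) (sp \<squnion>\<^sub>n sm) \<eta>s (tp \<squnion>\<^sub>n tm) \<eta>t (ereal m) \<and>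
        (\<forall>i\<in>\<Sigma>. direct_sum (g i) (tp i) (tm i)))"

text \<open>Only the span is formed here; that the sum is direct has to be asserted separately.\<close>

definition hat_map ::
  "(real^'n \<Rightarrow> real^'n \<Rightarrow> real) \<Rightarrow> (int list \<Rightarrow> (real^'n) set) \<Rightarrow> (int list \<Rightarrow> (real^'n) set)
    \<Rightarrow> int list \<Rightarrow> (real^'n) set" where
  "hat_map B f t i = span (t i \<union> (f i \<inter> perp B (t i)))"

end

theory Submission
  imports Defs
begin

text \<open>Let \<open>\<mu>\<close> be a Moutard lift of \<open>s\<^sup>+\<close> with \<open>(\<mu>\<^sub>i, \<mu>\<^sub>j) \<noteq> 0\<close> on all edges. An isotropic Darboux
  partner \<open>s\<^sup>-\<close> inside \<open>f\<close> can be described linearly: write its Moutard lift as \<open>v\<^sub>i / c\<^sub>i\<close> with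
  \<open>v\<^sub>i \<in> f\<^sub>i\<close> and \<open>c\<^sub>i \<in> \<real>\<close>. The Moutard equation on the square over an edge then becomes
  \<open>v\<^sub>i + v\<^sub>j = c\<^sub>j \<mu>\<^sub>i + c\<^sub>i \<mu>\<^sub>j\<close>, which is linear in \<open>(v, c)\<close>. It implies
  \<open>(v\<^sub>i, v\<^sub>j) = c\<^sub>i c\<^sub>j (\<mu>\<^sub>i, \<mu>\<^sub>j)\<close> on edges and \<open>(v\<^sub>i, v\<^sub>k) = c\<^sub>j c\<^sub>l (\<mu>\<^sub>i, \<mu>\<^sub>k)\<close> on diagonals of squares.
  Hence all regularity conditions on \<open>s\<^sup>-\<close> and on \<open>s\<^sup>+ \<squnion> s\<^sup>-\<close> follow as soon as \<open>c\<^sub>i \<noteq> 0\<close> and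
  \<open>v\<^sub>i \<notin> s\<^sup>+\<^sub>i\<close>, and the edge-labels of \<open>s\<^sup>-\<close> are those of \<open>s\<^sup>+\<close> (locale \<open>isotropic_pair\<close>).

  The pairs \<open>(v, c)\<close> are the parallel sections of a connection on the bundle with fibres
  \<open>f\<^sub>i \<times> \<real>\<close>. The Moutard equation for \<open>\<mu>\<close> makes this connection flat, so over a simply connected
  domain a parallel section takes any prescribed value at any one point (locale
  \<open>flat_connection\<close>).

  Now let \<open>\<nu>\<close> be the lift of the Darboux transform of \<open>s\<^sup>+\<close>, so \<open>(\<mu>\<^sub>i, \<nu>\<^sub>i) = 1/m\<close>. The formulas
  \<open>c'\<^sub>i = m (v\<^sub>i, \<nu>\<^sub>i)\<close> and \<open>v'\<^sub>i = c\<^sub>i \<nu>\<^sub>i + c'\<^sub>i \<mu>\<^sub>i - v\<^sub>i\<close> extend \<open>(v, c)\<close> to \<open>{0,1} \<times> \<Sigma>\<close> as a solution of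
  the same linear equation for the lift \<open>\<mu> \<squnion> \<nu>\<close> (\<open>isotropic_data_cyl\<close>). So the statement about
  isotropic pairs, applied over \<open>{0,1} \<times> \<Sigma>\<close>, provides the transform of \<open>s\<^sup>-\<close> and the regular net
  on \<open>{0,1}\<^sup>2 \<times> \<Sigma>\<close> at once. The new line \<open>[v'\<^sub>i]\<close> lies in the plane spanned by \<open>\<nu>\<^sub>i\<close> and the vectors of
  \<open>f\<^sub>i\<close> orthogonal to \<open>\<nu>\<^sub>i\<close>, because \<open>v\<^sub>i - c'\<^sub>i \<mu>\<^sub>i\<close> is such a vector. That
  these planes form a Legendre map is again the Moutard equation for \<open>\<mu> \<squnion> \<nu>\<close> over an edge
  (\<open>legendre_map_hat\<close>). What remains is to choose a
  parallel section with \<open>c\<^sub>i \<noteq> 0\<close>, \<open>c'\<^sub>i \<noteq> 0\<close> and \<open>v\<^sub>i \<notin> s\<^sup>+\<^sub>i\<close> for all \<open>i\<close>; each condition excludes a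
  proper subspace of the initial values, and countably many of those do not exhaust them by
  Baire's theorem (\<open>isotropic_data_exists\<close>).

  Conversely, for a Darboux transform \<open>g\<close> of \<open>f\<close>, the Moutard equation on the square formed by the
  four lines over \<open>i\<close> exhibits a nonzero vector of \<open>f\<^sub>i \<inter> g\<^sub>i\<close>. As \<open>g\<^sub>i\<close> is null, this vector spans
  the orthogonal of the transformed line in \<open>f\<^sub>i\<close> and determines \<open>g\<^sub>i\<close>
  (\<open>hat_map_of_darboux_pair\<close>). The label \<open>\<infinity>\<close> is excluded for \<open>s\<^sup>+\<close>, since \<open>s\<^sup>+\<^sub>i \<bottom> s\<^sup>+\<^sub>j\<close> would force
  \<open>s\<^sup>+\<^sub>i \<bottom> f\<^sub>j\<close>, against the regularity of \<open>s\<^sup>+ \<squnion> s\<^sup>-\<close> (\<open>not_infinite_label\<close>).\<close>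

section \<open>Exterior algebra\<close>

lemma wedge_add_left: "wedge (u + u') w = wedge u w + wedge u' w"
  and wedge_add_right: "wedge u (w + w') = wedge u w + wedge u w'"
  and wedge_diff_left: "wedge (u - u') w = wedge u w - wedge u' w"
  and wedge_diff_right: "wedge u (w - w') = wedge u w - wedge u w'"
  and wedge_minus_left: "wedge (- u) w = - wedge u w"
  and wedge_minus_right: "wedge u (- w) = - wedge u w"
  and wedge_scaleR_left: "wedge (r *\<^sub>R u) w = r *\<^sub>R wedge u w"
  and wedge_scaleR_right: "wedge u (r *\<^sub>R w) = r *\<^sub>R wedge u w"
  by (simp_all add: wedge_def vec_eq_iff algebra_simps)

lemmas wedge_simps = wedge_add_left wedge_add_right wedge_diff_left wedge_diff_right
  wedge_minus_left wedge_minus_right wedge_scaleR_left wedge_scaleR_right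

lemma wedge_self [simp]: "wedge u u = 0"
  and wedge_0_left [simp]: "wedge 0 u = 0"
  and wedge_0_right [simp]: "wedge u 0 = 0"
  by (simp_all add: wedge_def vec_eq_iff)

lemma wedge_swap: "wedge w u = - wedge u w"
  by (simp add: wedge_def vec_eq_iff)

lemma wedge_eq_0_collinear:
  assumes "wedge a b = 0" and "a \<noteq> 0"
  obtains r where "b = r *\<^sub>R a"
proof -
  obtain n where n: "a $ n \<noteq> 0"
    using \<open>a \<noteq> 0\<close> by (auto simp: vec_eq_iff)
  have "a $ n * b $ k = a $ k * b $ n" for k
    using assms(1) by (simp add: wedge_def vec_eq_iff mult.commute)
  then have "b = (b $ n / a $ n) *\<^sub>R a"
    using n by (simp add: vec_eq_iff field_simps)
  then show thesis using that by blast
qed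

lemma wedge_eq_0_in_span: "a \<noteq> 0 \<Longrightarrow> wedge a b = 0 \<longleftrightarrow> b \<in> span {a}"
  by (auto simp: span_singleton wedge_simps elim: wedge_eq_0_collinear)

lemma wedge_in_wedge_space: "u \<in> U \<Longrightarrow> w \<in> W \<Longrightarrow> wedge u w \<in> wedge_space U W"
  by (auto simp: wedge_space_def intro: span_base)

lemma wedge21_add: "wedge21 (\<omega> + \<omega>') x = wedge21 \<omega> x + wedge21 \<omega>' x"
  and wedge21_diff: "wedge21 (\<omega> - \<omega>') x = wedge21 \<omega> x - wedge21 \<omega>' x"
  and wedge21_scaleR: "wedge21 (r *\<^sub>R \<omega>) x = r *\<^sub>R wedge21 \<omega> x"
  and wedge21_0: "wedge21 0 x = 0"
  and wedge21_0_right: "wedge21 \<omega> 0 = 0"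
  by (simp_all add: wedge21_def vec_eq_iff algebra_simps)

lemma wedge21_wedge_combination: "wedge21 (wedge a b) (x *\<^sub>R a + y *\<^sub>R b) = 0"
  by (simp add: wedge21_def wedge_def vec_eq_iff algebra_simps)

lemma in_span_pairE:
  assumes "x \<in> span {a, b}"
  obtains p q where "x = p *\<^sub>R a + q *\<^sub>R b"
proof -
  obtain p where "x - p *\<^sub>R a \<in> span {b}"
    using assms unfolding span_breakdown_eq by blast
  then obtain q where "x - p *\<^sub>R a = q *\<^sub>R b"
    unfolding span_singleton by blast
  then show thesis using that[of p q] by (simp add: diff_eq_eq add.commute)
qed

lemma span_union_lines: "span (span {a} \<union> span {b}) = span {a, b}"
proof (rule subset_antisym)
  show "span (span {a} \<union> span {b}) \<subseteq> span {a, b}"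
    by (rule span_minimal) (simp_all add: span_mono)
  show "span {a, b} \<subseteq> span (span {a} \<union> span {b})"
    by (rule span_minimal) (auto intro: span_base)
qed

lemma plane_eq_span:
  assumes "subspace F" "dim F = 2" "a \<in> F" "b \<in> F" "wedge a b \<noteq> 0"
  shows "F = span {a, b}"
proof -
  have "a \<noteq> 0" using assms(5) by auto
  then have "independent {b, a}"
    using assms(5) by (simp add: independent_insert wedge_eq_0_in_span)
  moreover have "a \<noteq> b" using assms(5) by auto
  ultimately have "dim {a, b} = 2"
    by (metis dim_eq_card_independent card_2_iff insert_commute)
  then have "dim F \<le> dim (span {a, b})" using assms(2) by (simp add: dim_span)
  moreover have "span {a, b} \<subseteq> F"
    using assms(1,3,4) by (simp add: span_minimal)
  ultimately show ?thesis
    using subspace_dim_equal[OF subspace_span assms(1)] by auto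
qed

lemma line_eq_span:
  fixes L :: "'a::euclidean_space set"
  assumes "subspace L" "dim L = 1" "a \<in> L" "a \<noteq> 0"
  shows "L = span {a}"
proof -
  have "dim {a} = 1"
    using \<open>a \<noteq> 0\<close> by (simp add: dim_eq_card_independent)
  then have "dim L \<le> dim (span {a})" using assms(2) by (simp add: dim_span)
  moreover have "span {a} \<subseteq> L"
    using assms(1,3) by (simp add: span_minimal)
  ultimately show ?thesis
    using subspace_dim_equal[OF subspace_span[of "{a}"] assms(1)] by metis
qed

lemma plane_not_in_line:
  fixes F :: "'a::euclidean_space set"
  assumes "subspace F" "dim F = 2"
  obtains b where "b \<in> F" "b \<notin> span {a}"
proof -
  have "dim (span {a}) \<le> 1"
    using dim_le_card[of "span {a}" "{a}"] by simp
  then have "\<not> F \<subseteq> span {a}"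
    using dim_subset[of F "span {a}"] assms(2) by auto
  then show thesis using that by auto
qed

text \<open>The product lies in the third exterior power of a plane.\<close>

lemma wedge21_Lambda2_plane:
  assumes "subspace F" "dim F = 2" "\<tau> \<in> Lambda2 F" "x \<in> F"
  shows "wedge21 \<tau> x = 0"
proof -
  have "wedge21 (wedge u w) x = 0" if "u \<in> F" "w \<in> F" for u w
  proof (cases "wedge u w = 0")
    case True
    then show ?thesis by (simp add: wedge21_0)
  next
    case False
    then have "x \<in> span {u, w}"
      using plane_eq_span assms that by blast
    then show ?thesis
      by (metis in_span_pairE wedge21_wedge_combination)
  qed
  moreover have "subspace {\<omega>. wedge21 \<omega> x = 0}"
    by (auto simp: subspace_def wedge21_add wedge21_scaleR wedge21_0)
  ultimately have "Lambda2 F \<subseteq> {\<omega>. wedge21 \<omega> x = 0}"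
    unfolding wedge_space_def by (intro span_minimal) auto
  then show ?thesis using assms(3) by auto
qed

lemma dim_ge_3:
  fixes a b c :: "'a::euclidean_space"
  assumes "\<And>x y z. x *\<^sub>R a + y *\<^sub>R b + z *\<^sub>R c = 0 \<Longrightarrow> x = 0 \<and> y = 0 \<and> z = 0"
    and "{a, b, c} \<subseteq> S"
  shows "dim S \<ge> 3"
proof -
  have a: "a \<noteq> 0" using assms(1)[of 1 0 0] by auto
  have b: "b \<notin> span {a}"
  proof
    assume "b \<in> span {a}"
    then obtain r where "b = r *\<^sub>R a" by (auto simp: span_singleton)
    then show False using assms(1)[of r "-1" 0] by auto
  qed
  have c: "c \<notin> span {b, a}"
  proof
    assume "c \<in> span {b, a}"
    then obtain r t where "c - t *\<^sub>R b = r *\<^sub>R a" by (auto simp: span_breakdown_eq span_singleton)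
    then have "r *\<^sub>R a + t *\<^sub>R b + (-1) *\<^sub>R c = 0"
      by (metis add.commute diff_add_cancel diff_self scaleR_minus1_left uminus_add_conv_diff)
    from assms(1)[OF this] show False by simp
  qed
  have ind: "independent {c, b, a}"
    by (intro independent_insertI a b c independent_empty) (simp add: a)
  have "b \<noteq> a" "c \<noteq> a" "c \<noteq> b"
    using b c span_base by blast+
  then have "card {c, b, a} = 3" by auto
  moreover have "{c, b, a} \<subseteq> S" using assms(2) by auto
  ultimately show ?thesis
    using independent_card_le_dim[of "{c, b, a}" S] ind by simp
qed

section \<open>Edges and squares of a domain and of the cylinder over it\<close>

lemma edgeI:
  "i \<in> D \<Longrightarrow> j \<in> D \<Longrightarrow> a < length i \<Longrightarrow> e \<in> {1, -1} \<Longrightarrow> j = i[a := i ! a + e] \<Longrightarrow> edge D i j"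
  unfolding edge_def by blast

lemma edgeE:
  assumes "edge D i j"
  obtains a e where "i \<in> D" "j \<in> D" "a < length i" "e \<in> {1, -1}" "j = i[a := i ! a + e]"
  using assms unfolding edge_def by blast

lemma quadI:
  "i \<in> D \<Longrightarrow> j \<in> D \<Longrightarrow> k \<in> D \<Longrightarrow> l \<in> D \<Longrightarrow> a < length i \<Longrightarrow> b < length i \<Longrightarrow> a \<noteq> b \<Longrightarrow>
   e \<in> {1, -1} \<Longrightarrow> d \<in> {1, -1} \<Longrightarrow> j = i[a := i ! a + e] \<Longrightarrow> l = i[b := i ! b + d] \<Longrightarrow>
   k = i[a := i ! a + e, b := i ! b + d] \<Longrightarrow> quad D i j k l"
  unfolding quad_def by blast

lemma quadE:
  assumes "quad D i j k l"
  obtains a b e d where "i \<in> D" "j \<in> D" "k \<in> D" "l \<in> D"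
    "a < length i" "b < length i" "a \<noteq> b" "e \<in> {1, -1}" "d \<in> {1, -1}"
    "j = i[a := i ! a + e]" "l = i[b := i ! b + d]" "k = i[a := i ! a + e, b := i ! b + d]"
  using assms unfolding quad_def by blast

lemma edge_sym: "edge D i j \<Longrightarrow> edge D j i"
proof (elim edgeE)
  fix a and e :: int
  assume "i \<in> D" "j \<in> D" "a < length i" "e \<in> {1, -1}" "j = i[a := i ! a + e]"
  then show "edge D j i" by (intro edgeI[of _ _ _ a "- e"]) auto
qed

lemma edge_in_domain: "edge D i j \<Longrightarrow> i \<in> D" "edge D i j \<Longrightarrow> j \<in> D"
  by (auto simp: edge_def)

lemma quad_in_domain: "quad D i j k l \<Longrightarrow> i \<in> D \<and> j \<in> D \<and> k \<in> D \<and> l \<in> D"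
  by (auto simp: quad_def)

lemma quad_edge: "quad D i j k l \<Longrightarrow> edge D i j"
  by (elim quadE) (rule edgeI)

lemma quad_reflect: "quad D i j k l \<Longrightarrow> quad D i l k j"
proof (elim quadE)
  fix a b and e d :: int
  assume "i \<in> D" "j \<in> D" "k \<in> D" "l \<in> D"
    "a < length i" "b < length i" "a \<noteq> b" "e \<in> {1, -1}" "d \<in> {1, -1}"
    "j = i[a := i ! a + e]" "l = i[b := i ! b + d]" "k = i[a := i ! a + e, b := i ! b + d]"
  then show "quad D i l k j"
    by (intro quadI[of i D l k j b a d e]) (auto simp: list_update_swap)
qed

lemma quad_rotate: "quad D i j k l \<Longrightarrow> quad D j k l i"
proof (elim quadE)
  fix a b and e d :: int
  assume "i \<in> D" "j \<in> D" "k \<in> D" "l \<in> D"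
    "a < length i" "b < length i" "a \<noteq> b" "e \<in> {1, -1}" "d \<in> {1, -1}"
    "j = i[a := i ! a + e]" "l = i[b := i ! b + d]" "k = i[a := i ! a + e, b := i ! b + d]"
  then show "quad D j k l i"
    by (intro quadI[of j D k l i b a d "- e"]) (auto simp: list_update_swap)
qed

lemma Cons_in_cyl [simp]: "b # i \<in> cyl D \<longleftrightarrow> b \<in> {0, 1} \<and> i \<in> D"
  by (auto simp: cyl_def)

lemma in_cylE:
  assumes "x \<in> cyl D"
  obtains b i where "x = b # i" "b \<in> {0, 1}" "i \<in> D"
  using assms by (auto simp: cyl_def)

lemma join_Cons [simp]: "(u \<squnion>\<^sub>n v) (b # i) = (if b = 0 then u i else v i)"
  by (simp add: join_def)

lemma edge_Cons_level: "b \<in> {0, 1} \<Longrightarrow> edge D i j \<Longrightarrow> edge (cyl D) (b # i) (b # j)"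
  by (elim edgeE, rule edgeI[where a="Suc _"]) auto

lemma quad_Cons_level:
  assumes "b \<in> {0, 1}" "quad D i j k l"
  shows "quad (cyl D) (b # i) (b # j) (b # k) (b # l)"
  using assms(2)
proof (elim quadE)
  fix a b' and e d :: int
  assume "i \<in> D" "j \<in> D" "k \<in> D" "l \<in> D"
    "a < length i" "b' < length i" "a \<noteq> b'" "e \<in> {1, -1}" "d \<in> {1, -1}"
    "j = i[a := i ! a + e]" "l = i[b' := i ! b' + d]" "k = i[a := i ! a + e, b' := i ! b' + d]"
  then show ?thesis
    using assms(1) by (intro quadI[of _ _ _ _ _ "Suc a" "Suc b'" e d]) auto
qed

lemma edge_vertical: "i \<in> D \<Longrightarrow> edge (cyl D) (0 # i) (1 # i)"
  unfolding edge_def by (auto intro!: exI[of _ 0])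

lemma quad_vertical:
  assumes "edge D i j"
  shows "quad (cyl D) (0 # i) (0 # j) (1 # j) (1 # i)"
  using assms
proof (elim edgeE)
  fix a and e :: int
  assume "i \<in> D" "j \<in> D" "a < length i" "e \<in> {1, -1}" "j = i[a := i ! a + e]"
  then show ?thesis by (intro quadI[of _ _ _ _ _ "Suc a" 0 e 1]) auto
qed

lemma edge_cyl_cases:
  assumes "edge (cyl D) x y"
  obtains (level) b i j where "x = b # i" "y = b # j" "b \<in> {0, 1}" "edge D i j"
    | (up) i where "x = 0 # i" "y = 1 # i" "i \<in> D"
    | (down) i where "x = 1 # i" "y = 0 # i" "i \<in> D"
proof -
  obtain a e where *: "x \<in> cyl D" "y \<in> cyl D" "a < length x" "e \<in> {1, -1}" "y = x[a := x ! a + e]"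
    using assms by (rule edgeE)
  obtain b i where x: "x = b # i" "b \<in> {0, 1}" "i \<in> D"
    using *(1) by (rule in_cylE)
  show thesis
  proof (cases a)
    case 0
    then show ?thesis using * x up down by auto
  next
    case (Suc a')
    then have "edge D i (i[a' := i ! a' + e])"
      using * x by (intro edgeI[of _ _ _ a' e]) auto
    then show ?thesis using * x Suc level by auto
  qed
qed

text \<open>A square of the cylinder lies in one of the two levels or stands over an edge. Its eight
  labellings are generated by rotation and reflection, so for a property invariant under these one
  labelling of each kind suffices.\<close>

lemma quad_cyl_induct [consumes 1, case_names level vertical rotate reflect]:
  assumes "quad (cyl D) x y z w"
    and level: "\<And>b i j k l. b \<in> {0, 1} \<Longrightarrow> quad D i j k l \<Longrightarrow> P (b # i) (b # j) (b # k) (b # l)"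
    and vertical: "\<And>i j. edge D i j \<Longrightarrow> P (0 # i) (0 # j) (1 # j) (1 # i)"
    and rotate: "\<And>x y z w. P x y z w \<Longrightarrow> P y z w x"
    and reflect: "\<And>x y z w. P x y z w \<Longrightarrow> P x w z y"
  shows "P x y z w"
proof -
  obtain a b e d where *: "x \<in> cyl D" "y \<in> cyl D" "z \<in> cyl D" "w \<in> cyl D"
      "a < length x" "b < length x" "a \<noteq> b" "e \<in> {1, -1}" "d \<in> {1, -1}"
      "y = x[a := x ! a + e]" "w = x[b := x ! b + d]" "z = x[a := x ! a + e, b := x ! b + d]"
    using assms(1) by (rule quadE)
  obtain h i where x: "x = h # i" "h \<in> {0, 1}" "i \<in> D"
    using *(1) by (rule in_cylE)
  have side: "P (h # i) (h # j) (h' # j) (h' # i)"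
    if "edge D i j" "h \<in> {0, 1}" "h' \<in> {0, 1}" "h \<noteq> h'" for h h' i j
  proof (cases "h = 0")
    case True
    then show ?thesis using that vertical by auto
  next
    case False
    then have "h = 1" "h' = 0" using that by auto
    then show ?thesis
      using rotate[OF rotate[OF vertical[OF edge_sym[OF that(1)]]]] by simp
  qed
  show ?thesis
  proof (cases a)
    case 0
    then obtain b' where b: "b = Suc b'" using * by (cases b) auto
    define j where "j = i[b' := i ! b' + d]"
    have j: "edge D i j" unfolding j_def using * x b 0 by (intro edgeI[of _ _ _ b' d]) auto
    have "P (h # i) (h # j) ((h + e) # j) ((h + e) # i)"
      using side[OF j] * x 0 by auto
    from reflect[OF this] show ?thesis using * x b 0 by (simp add: j_def)
  next
    case (Suc a')
    show ?thesis
    proof (cases b)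
      case 0
      define j where "j = i[a' := i ! a' + e]"
      have j: "edge D i j" unfolding j_def using * x Suc 0 by (intro edgeI[of _ _ _ a' e]) auto
      have "P (h # i) (h # j) ((h + d) # j) ((h + d) # i)"
        using side[OF j] * x 0 by auto
      then show ?thesis using * x Suc 0 by (simp add: j_def)
    next
      case (Suc b')
      note a = \<open>a = Suc a'\<close>
      have "quad D i (i[a' := i ! a' + e]) (i[a' := i ! a' + e, b' := i ! b' + d]) (i[b' := i ! b' + d])"
        using * x Suc a by (intro quadI[of _ _ _ _ _ a' b' e d]) auto
      from level[OF x(2) this] show ?thesis using * x Suc a by simp
    qed
  qed
qed

text \<open>Nets, closed 1-forms and Moutard lifts pull back along these maps. They serve to restrict to
  the levels of a cylinder and to permute its coordinates.\<close>

definition domain_map :: "int list set \<Rightarrow> int list set \<Rightarrow> (int list \<Rightarrow> int list) \<Rightarrow> bool" where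
  "domain_map D D' \<phi> \<longleftrightarrow> \<phi> ` D \<subseteq> D' \<and> (\<forall>i j. edge D i j \<longrightarrow> edge D' (\<phi> i) (\<phi> j)) \<and>
     (\<forall>i j k l. quad D i j k l \<longrightarrow> quad D' (\<phi> i) (\<phi> j) (\<phi> k) (\<phi> l))"

lemma domain_map_cong:
  assumes "domain_map D D' \<phi>" "\<And>i. i \<in> D \<Longrightarrow> \<phi>' i = \<phi> i"
  shows "domain_map D D' \<phi>'"
proof -
  have "edge D' (\<phi>' i) (\<phi>' j)" if "edge D i j" for i j
    using that assms edge_in_domain unfolding domain_map_def by metis
  moreover have "quad D' (\<phi>' i) (\<phi>' j) (\<phi>' k) (\<phi>' l)" if "quad D i j k l" for i j k l
    using that assms quad_in_domain[OF that] unfolding domain_map_def by metis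
  ultimately show ?thesis
    using assms unfolding domain_map_def by auto
qed

lemma domain_map_level: "b \<in> {0, 1} \<Longrightarrow> domain_map D (cyl D) ((#) b)"
  by (auto simp: domain_map_def edge_Cons_level quad_Cons_level)

lemma domain_map_comp: "domain_map D D' \<phi> \<Longrightarrow> domain_map D' D'' \<psi> \<Longrightarrow> domain_map D D'' (\<psi> \<circ> \<phi>)"
  by (auto simp: domain_map_def)

text \<open>Over \<open>cyl (cyl D)\<close> this exchanges the two coordinates in \<open>{0,1}\<close> and so turns
  \<open>(s \<squnion>\<^sub>n t) \<squnion>\<^sub>n (s' \<squnion>\<^sub>n t')\<close> into \<open>(s \<squnion>\<^sub>n s') \<squnion>\<^sub>n (t \<squnion>\<^sub>n t')\<close>.\<close>

fun swap2 :: "int list \<Rightarrow> int list" where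
  "swap2 (a # b # i) = b # a # i"
| "swap2 i = i"

lemma domain_map_swap2: "domain_map (cyl (cyl D)) (cyl (cyl D)) swap2"
proof -
  \<comment> \<open>the permutation of coordinate positions induced by the exchange\<close>
  define \<pi> :: "nat \<Rightarrow> nat" where "\<pi> = (\<lambda>n. if n = 0 then 1 else if n = 1 then 0 else n)"
  have mem: "swap2 x \<in> cyl (cyl D)" if "x \<in> cyl (cyl D)" for x
    using that by (auto elim!: in_cylE)
  have len: "\<pi> n < length (swap2 x)" if "length x \<ge> 2" "n < length x" for x n
    using that by (cases x rule: swap2.cases; cases n; cases "n - 1"; auto simp: \<pi>_def)
  have long: "length x \<ge> 2" if "x \<in> cyl (cyl D)" for x
    using that by (auto elim!: in_cylE)
  have nth: "swap2 x ! \<pi> n = x ! n" if "length x \<ge> 2" for x n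
    using that by (cases x rule: swap2.cases; cases n; cases "n - 1"; auto simp: \<pi>_def)
  have upd: "swap2 (x[n := r]) = (swap2 x)[\<pi> n := r]" if "length x \<ge> 2" for x n r
    using that by (cases x rule: swap2.cases; cases n; cases "n - 1"; auto simp: \<pi>_def)
  have inj: "\<pi> a \<noteq> \<pi> b" if "a \<noteq> b" for a b
    using that by (auto simp: \<pi>_def)
  show ?thesis unfolding domain_map_def
  proof (intro conjI allI impI)
    show "swap2 ` cyl (cyl D) \<subseteq> cyl (cyl D)" using mem by auto
    fix x y assume "edge (cyl (cyl D)) x y"
    then obtain a e where *: "x \<in> cyl (cyl D)" "y \<in> cyl (cyl D)" "a < length x" "e \<in> {1, -1}"
        "y = x[a := x ! a + e]"
      by (rule edgeE)
    show "edge (cyl (cyl D)) (swap2 x) (swap2 y)"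
      using * mem[OF *(1)] mem[OF *(2)] upd[OF long[OF *(1)]] nth[OF long[OF *(1)]]
        len[OF long[OF *(1)]]
      by (intro edgeI[of _ _ _ "\<pi> a" e]) auto
  next
    fix x y z w assume "quad (cyl (cyl D)) x y z w"
    then obtain a b e d where *: "x \<in> cyl (cyl D)" "y \<in> cyl (cyl D)" "z \<in> cyl (cyl D)"
        "w \<in> cyl (cyl D)" "a < length x" "b < length x" "a \<noteq> b" "e \<in> {1, -1}" "d \<in> {1, -1}"
        "y = x[a := x ! a + e]" "w = x[b := x ! b + d]" "z = x[a := x ! a + e, b := x ! b + d]"
      by (rule quadE)
    have l: "length x \<ge> 2" using long * by auto
    then have l': "length (x[a := r]) \<ge> 2" for r by simp
    show "quad (cyl (cyl D)) (swap2 x) (swap2 y) (swap2 z) (swap2 w)"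
      using * mem[OF *(1)] mem[OF *(2)] mem[OF *(3)] mem[OF *(4)] len[OF l] inj upd[OF l] upd[OF l'] nth[OF l]
      by (intro quadI[of _ _ _ _ _ "\<pi> a" "\<pi> b" e d]) auto
  qed
qed

section \<open>Moutard nets\<close>

locale symmetric_form =
  fixes B :: "real^'n \<Rightarrow> real^'n \<Rightarrow> real"
  assumes bilinear: "bilinear B" and sym: "B x y = B y x"
begin

lemmas form_simps = bilinear_ladd[OF bilinear] bilinear_radd[OF bilinear]
  bilinear_lsub[OF bilinear] bilinear_rsub[OF bilinear]
  bilinear_lmul[OF bilinear] bilinear_rmul[OF bilinear]
  bilinear_lneg[OF bilinear] bilinear_rneg[OF bilinear]
  bilinear_lzero[OF bilinear] bilinear_rzero[OF bilinear]

lemma wedge_nonzero_if_not_orthogonal: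
  assumes "B a a = 0" "B a b \<noteq> 0"
  shows "wedge a b \<noteq> 0"
proof
  assume "wedge a b = 0"
  moreover have "a \<noteq> 0" using assms(2) by (auto simp: form_simps)
  ultimately obtain r where "b = r *\<^sub>R a" by (rule wedge_eq_0_collinear)
  then show False using assms by (simp add: form_simps)
qed

text \<open>The Gram matrix of three such vectors has determinant \<open>2 (a,b) (b,c) (a,c)\<close>.\<close>

lemma independent_if_not_orthogonal:
  assumes "B a a = 0" "B b b = 0" "B c c = 0" "B a b \<noteq> 0" "B b c \<noteq> 0" "B a c \<noteq> 0"
    and rel: "x *\<^sub>R a + y *\<^sub>R b + z *\<^sub>R c = 0"
  shows "x = 0 \<and> y = 0 \<and> z = 0"
proof -
  have "B a (x *\<^sub>R a + y *\<^sub>R b + z *\<^sub>R c) = 0" "B b (x *\<^sub>R a + y *\<^sub>R b + z *\<^sub>R c) = 0"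
    "B c (x *\<^sub>R a + y *\<^sub>R b + z *\<^sub>R c) = 0"
    by (simp_all only: rel form_simps)
  then have 1: "y * B a b + z * B a c = 0" and 2: "x * B a b + z * B b c = 0"
    and 3: "x * B a c + y * B b c = 0"
    using assms(1-3) sym[of b a] sym[of c a] sym[of c b] by (simp_all add: form_simps)
  have "2 * z * B a c * B b c = 0"
    using 1 2 3 by algebra
  then have "z = 0" using assms by simp
  then show ?thesis using 1 2 assms by simp
qed

end

text \<open>The first condition says that \<open>wedge (M j) (M i)\<close> is closed on the square; it is the Moutard
  equation: the differences along the two diagonals are proportional.\<close>

definition moutard_quad ::
  "(real^'n \<Rightarrow> real^'n \<Rightarrow> real) \<Rightarrow> real^'n \<Rightarrow> real^'n \<Rightarrow> real^'n \<Rightarrow> real^'n \<Rightarrow> bool" where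
  "moutard_quad B a b c d \<longleftrightarrow>
     wedge (a - c) (d - b) = 0 \<and> B a c \<noteq> 0 \<and> B b d \<noteq> 0 \<and> dim {a, b, c, d} \<ge> 3"

text \<open>Isothermic nets seen through their Moutard lifts; \<open>moutard_net_isothermic\<close> and
  \<open>isothermic_moutard_net\<close> translate between the two descriptions. Distinctness of the four lines on a square is encoded by \<open>wedge (M j) (M i) \<noteq> 0\<close> for adjacent
  vertices and by non-orthogonality for opposite ones.\<close>

definition moutard_net ::
  "(real^'n \<Rightarrow> real^'n \<Rightarrow> real) \<Rightarrow> int list set \<Rightarrow> (int list \<Rightarrow> real^'n) \<Rightarrow> bool" where
  "moutard_net B D M \<longleftrightarrow> (\<forall>i\<in>D. M i \<noteq> 0 \<and> B (M i) (M i) = 0) \<and>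
     (\<forall>i j. edge D i j \<longrightarrow> wedge (M j) (M i) \<noteq> 0) \<and>
     (\<forall>i j k l. quad D i j k l \<longrightarrow> moutard_quad B (M i) (M j) (M k) (M l))"

lemma wedge_diff_cycle:
  "wedge (a - c) (d - b) = wedge a d + wedge d c + wedge c b + wedge b a"
  using wedge_swap[of a b] wedge_swap[of c d] by (simp add: wedge_simps)

lemma moutard_net_null: "moutard_net B D M \<Longrightarrow> i \<in> D \<Longrightarrow> B (M i) (M i) = 0"
  and moutard_net_nonzero: "moutard_net B D M \<Longrightarrow> i \<in> D \<Longrightarrow> M i \<noteq> 0"
  and moutard_net_edge: "moutard_net B D M \<Longrightarrow> edge D i j \<Longrightarrow> wedge (M j) (M i) \<noteq> 0"
  and moutard_net_quad:
    "moutard_net B D M \<Longrightarrow> quad D i j k l \<Longrightarrow> moutard_quad B (M i) (M j) (M k) (M l)"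
  by (auto simp: moutard_net_def)

lemma moutard_net_cong:
  assumes "moutard_net B D M" "\<And>i. i \<in> D \<Longrightarrow> M' i = M i"
  shows "moutard_net B D M'"
  unfolding moutard_net_def
proof (intro conjI allI impI ballI)
  fix i assume "i \<in> D"
  then show "M' i \<noteq> 0" "B (M' i) (M' i) = 0"
    using assms by (auto simp: moutard_net_def)
next
  fix i j assume "edge D i j"
  then show "wedge (M' j) (M' i) \<noteq> 0"
    using moutard_net_edge[OF assms(1)] edge_in_domain assms(2) by metis
next
  fix i j k l assume "quad D i j k l"
  then show "moutard_quad B (M' i) (M' j) (M' k) (M' l)"
    using moutard_net_quad[OF assms(1)] quad_in_domain assms(2) by metis
qed

lemma moutard_net_pullback:
  assumes "domain_map D D' \<phi>" "moutard_net B D' M"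
  shows "moutard_net B D (\<lambda>i. M (\<phi> i))"
  using assms unfolding domain_map_def moutard_net_def by auto

lemma isothermic_pullback:
  assumes "domain_map D D' \<phi>" "isothermic B D' s \<eta>"
  shows "isothermic B D (\<lambda>i. s (\<phi> i)) (\<lambda>j i. \<eta> (\<phi> j) (\<phi> i))"
proof -
  have \<phi>: "\<And>i. i \<in> D \<Longrightarrow> \<phi> i \<in> D'" "\<And>i j. edge D i j \<Longrightarrow> edge D' (\<phi> i) (\<phi> j)"
    "\<And>i j k l. quad D i j k l \<Longrightarrow> quad D' (\<phi> i) (\<phi> j) (\<phi> k) (\<phi> l)"
    using assms(1) unfolding domain_map_def by auto
  have "regular_net B D (\<lambda>i. s (\<phi> i))"
    using \<phi> assms(2) unfolding isothermic_def regular_net_def by blast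
  moreover have "closed_form D (\<lambda>j i. \<eta> (\<phi> j) (\<phi> i))"
    using \<phi> assms(2) unfolding isothermic_def closed_form_def by blast
  ultimately show ?thesis
    using \<phi>(2) assms(2) unfolding isothermic_def by blast
qed

lemma moutard_lift_pullback:
  assumes "domain_map D D' \<phi>" "moutard_lift D' s \<eta> M"
  shows "moutard_lift D (\<lambda>i. s (\<phi> i)) (\<lambda>j i. \<eta> (\<phi> j) (\<phi> i)) (\<lambda>i. M (\<phi> i))"
  using assms unfolding domain_map_def moutard_lift_def by auto

lemma moutard_lift_cong:
  assumes "moutard_lift D s \<eta> M" "\<And>i. i \<in> D \<Longrightarrow> M' i = M i"
    and "\<And>i j. edge D i j \<Longrightarrow> \<eta>' j i = \<eta> j i"
  shows "moutard_lift D s \<eta>' M'"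
  using assms edge_in_domain unfolding moutard_lift_def by metis

context symmetric_form
begin

lemma moutard_quad_sym:
  assumes "moutard_quad B a b c d"
  shows "moutard_quad B b c d a" "moutard_quad B a d c b"
proof -
  have "{b, c, d, a} = {a, b, c, d}" "{a, d, c, b} = {a, b, c, d}" by auto
  moreover have "wedge (b - d) (a - c) = - wedge (a - c) (b - d)" by (rule wedge_swap)
  ultimately show "moutard_quad B b c d a" "moutard_quad B a d c b"
    using assms sym wedge_minus_right[of "a - c" "b - d"]
    unfolding moutard_quad_def by (simp_all add: wedge_diff_right)
qed

lemma moutard_coefficient:
  assumes "moutard_quad B a b c d" "B a a = 0" "B b b = 0"
  obtains r where "r \<noteq> 0" "c = a + r *\<^sub>R (b - d)"
proof -
  have "a - c \<noteq> 0" "b - d \<noteq> 0"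
    using assms unfolding moutard_quad_def by auto
  moreover have "wedge (b - d) (c - a) = 0"
    using assms(1) wedge_swap[of "b - d" "c - a"] wedge_minus_left[of "a - c" "d - b"]
      wedge_minus_right[of "a - c" "d - b"]
    unfolding moutard_quad_def by (simp add: wedge_diff_left wedge_diff_right algebra_simps)
  ultimately obtain r where "c - a = r *\<^sub>R (b - d)"
    using wedge_eq_0_collinear by blast
  with that[of r] \<open>a - c \<noteq> 0\<close> show thesis
    by (metis add.commute diff_add_cancel eq_iff_diff_eq_0 scaleR_zero_left)
qed

text \<open>Opposite edges of a square carry equal labels: expand \<open>B c c = 0\<close> and cancel \<open>r\<close>.\<close>

lemma opposite_edges:
  assumes "c = a + r *\<^sub>R (b - d)" "r \<noteq> 0"
    and "B a a = 0" "B b b = 0" "B c c = 0" "B d d = 0"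
  shows "B a d = B b c"
proof -
  have "B c c = B a a + 2 * r * B a (b - d) + r * r * B (b - d) (b - d)"
    unfolding assms(1) by (simp add: form_simps sym algebra_simps)
  then have "r * (2 * (B a b - B a d) - 2 * r * B b d) = 0"
    using assms(3-6) by (simp add: form_simps sym[of d b] algebra_simps)
  then have "B a b - B a d = r * B b d" using assms(2) by simp
  moreover have "B b c = B a b - r * B b d"
    unfolding assms(1) using assms(4) by (simp add: form_simps sym[of b a] algebra_simps)
  ultimately show ?thesis by simp
qed

lemma moutard_net_isothermic:
  assumes net: "moutard_net B D M" and s: "\<And>i. i \<in> D \<Longrightarrow> s i = span {M i}"
    and \<eta>: "\<And>i j. edge D i j \<Longrightarrow> \<eta> j i = wedge (M j) (M i)"
  shows "isothermic B D s \<eta>" "moutard_lift D s \<eta> M"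
proof -
  have mem: "M i \<in> s i" if "i \<in> D" for i
    using s[OF that] by (simp add: span_base)
  show "moutard_lift D s \<eta> M"
    unfolding moutard_lift_def using net mem \<eta> by (auto simp: moutard_net_def)
  have ne: "s i \<noteq> s j" if "wedge (M j) (M i) \<noteq> 0" "i \<in> D" "j \<in> D" for i j
    using that mem[of i] s[of j] moutard_net_nonzero[OF net, of j]
    by (metis wedge_eq_0_in_span)
  show "isothermic B D s \<eta>"
    unfolding isothermic_def regular_net_def
  proof (intro conjI ballI allI impI)
    fix i assume "i \<in> D"
    then show "s i \<in> quadric B"
      using moutard_net_null[OF net] moutard_net_nonzero[OF net] s[of i]
        dim_eq_card_independent[of "{M i}"]
      by (auto simp: quadric_def) (auto simp: span_singleton form_simps)
  next
    fix i j k l assume q: "quad D i j k l"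
    have dom: "i \<in> D" "j \<in> D" "k \<in> D" "l \<in> D" using quad_in_domain[OF q] by auto
    have edges: "edge D i j" "edge D j k" "edge D k l" "edge D l i"
      using q quad_edge quad_rotate by blast+
    have mq: "B (M i) (M k) \<noteq> 0" "B (M j) (M l) \<noteq> 0" "dim {M i, M j, M k, M l} \<ge> 3"
      using moutard_net_quad[OF net q] by (auto simp: moutard_quad_def)
    have diag: "wedge (M i) (M k) \<noteq> 0" "wedge (M j) (M l) \<noteq> 0"
      using mq dom moutard_net_null[OF net] by (simp_all add: wedge_nonzero_if_not_orthogonal)
    show "distinct [s i, s j, s k, s l]"
      using diag edges[THEN moutard_net_edge[OF net], THEN ne] dom
        ne[OF diag(1)] ne[OF diag(2)] by auto
    have "{M i, M j, M k, M l} \<subseteq> span (s i \<union> s j \<union> s k \<union> s l)"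
      using mem dom by (auto intro: span_base)
    then show "3 \<le> dim (span (s i \<union> s j \<union> s k \<union> s l))"
      using mq(3) dim_subset le_trans by blast
    show "\<not> s k \<subseteq> perp B (s i)" "\<not> s l \<subseteq> perp B (s j)"
      using mq mem dom by (auto simp: perp_def)
  next
    show "closed_form D \<eta>"
      unfolding closed_form_def
    proof (intro conjI allI impI)
      fix i j assume "edge D i j"
      then show "\<eta> j i = - \<eta> i j"
        using \<eta> edge_sym wedge_swap by metis
    next
      fix i j k l assume q: "quad D i j k l"
      have edges: "edge D i j" "edge D j k" "edge D k l" "edge D l i"
        using q quad_edge quad_rotate by blast+
      show "\<eta> i l + \<eta> l k + \<eta> k j + \<eta> j i = 0"
        using moutard_net_quad[OF net q] edges[THEN \<eta>]
        by (simp add: moutard_quad_def wedge_diff_cycle)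
    qed
  next
    fix i j assume e: "edge D i j"
    show "\<eta> j i \<noteq> 0" using moutard_net_edge[OF net e] \<eta>[OF e] by simp
    show "\<eta> j i \<in> wedge_space (s j) (s i)"
      using \<eta>[OF e] mem edge_in_domain[OF e] by (simp add: wedge_in_wedge_space)
  qed
qed

lemma isothermic_moutard_net:
  assumes iso: "isothermic B D s \<eta>" and lift: "moutard_lift D s \<eta> M"
  shows "moutard_net B D M" "\<And>i. i \<in> D \<Longrightarrow> s i = span {M i}"
    "\<And>i j. edge D i j \<Longrightarrow> \<eta> j i = wedge (M j) (M i)"
proof -
  show line: "s i = span {M i}" if "i \<in> D" for i
  proof (rule line_eq_span)
    show "subspace (s i)" "dim (s i) = 1" "M i \<in> s i" "M i \<noteq> 0"
      using iso lift that
      unfolding isothermic_def regular_net_def quadric_def moutard_lift_def by auto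
  qed
  show \<eta>: "\<eta> j i = wedge (M j) (M i)" if "edge D i j" for i j
    using lift that by (auto simp: moutard_lift_def)
  show "moutard_net B D M"
    unfolding moutard_net_def
  proof (intro conjI ballI allI impI)
    fix i assume "i \<in> D"
    then show "M i \<noteq> 0" "B (M i) (M i) = 0"
      using iso lift unfolding isothermic_def regular_net_def quadric_def moutard_lift_def by auto
  next
    fix i j assume "edge D i j"
    then show "wedge (M j) (M i) \<noteq> 0"
      using iso \<eta> unfolding isothermic_def by metis
  next
    fix i j k l assume q: "quad D i j k l"
    have dom: "i \<in> D" "j \<in> D" "k \<in> D" "l \<in> D" using quad_in_domain[OF q] by auto
    have edges: "edge D i j" "edge D j k" "edge D k l" "edge D l i"
      using q quad_edge quad_rotate by blast+
    have reg: "\<not> s k \<subseteq> perp B (s i)" "\<not> s l \<subseteq> perp B (s j)"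
      "dim (span (s i \<union> s j \<union> s k \<union> s l)) \<ge> 3"
      using iso q unfolding isothermic_def regular_net_def by blast+
    have closed: "\<eta> i l + \<eta> l k + \<eta> k j + \<eta> j i = 0"
      using iso q unfolding isothermic_def closed_form_def by blast
    have "B (M i) (M k) \<noteq> 0" "B (M j) (M l) \<noteq> 0"
      using reg dom line
      by (auto simp: perp_def span_singleton form_simps)
    moreover have "s i \<union> s j \<union> s k \<union> s l \<subseteq> span {M i, M j, M k, M l}"
      using line dom span_mono[of "{M _}" "{M i, M j, M k, M l}"] by auto
    then have "dim (span (s i \<union> s j \<union> s k \<union> s l)) \<le> dim (span {M i, M j, M k, M l})"
      by (metis dim_subset span_minimal subspace_span)
    ultimately show "moutard_quad B (M i) (M j) (M k) (M l)"
      using reg(3) closed edges[THEN \<eta>]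
      by (simp add: moutard_quad_def wedge_diff_cycle)
  qed
qed

text \<open>Two Moutard lifts differ at the ends of an edge by mutually inverse factors, because their
  exterior products agree; so any one lift computes the label.\<close>

lemma edge_label_iff:
  assumes iso: "isothermic B D s \<eta>" and lift: "moutard_lift D s \<eta> M" and e: "edge D i j"
  shows "edge_label B D s \<eta> i j x \<longleftrightarrow> x = 1 / ereal (B (M i) (M j))"
proof -
  have "B (\<mu> i) (\<mu> j) = B (M i) (M j)" if \<mu>: "moutard_lift D s \<eta> \<mu>" for \<mu>
  proof -
    note net = isothermic_moutard_net[OF iso lift]
    have "\<mu> i \<in> span {M i}" "\<mu> j \<in> span {M j}"
      using \<mu> net(2) edge_in_domain[OF e] by (auto simp: moutard_lift_def)
    then obtain a b where ab: "\<mu> i = a *\<^sub>R M i" "\<mu> j = b *\<^sub>R M j"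
      by (auto simp: span_singleton)
    have "wedge (M j) (M i) = (b * a) *\<^sub>R wedge (M j) (M i)"
    proof -
      have "wedge (M j) (M i) = wedge (\<mu> j) (\<mu> i)"
        using \<mu> e net(3)[OF e] unfolding moutard_lift_def by simp
      then show ?thesis by (simp add: ab wedge_simps mult.commute)
    qed
    then have "b * a = 1"
      using moutard_net_edge[OF net(1) e] by (metis scaleR_cancel_right scaleR_one)
    moreover have "B (\<mu> i) (\<mu> j) = (b * a) * B (M i) (M j)"
      unfolding ab form_simps by simp
    ultimately show ?thesis by simp
  qed
  then show ?thesis unfolding edge_label_def using lift e by metis
qed

end

section \<open>Isotropic Darboux pairs\<close>

text \<open>The unknowns of the linear description of isotropic Darboux partners: the partner of \<open>M\<close> has
  the Moutard lift \<open>v i /\<^sub>R c i\<close>. Keeping the factor \<open>c\<close> separate makes the Moutard equation on the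
  square over an edge linear.\<close>

definition isotropic_data ::
  "(real^'n \<Rightarrow> real^'n \<Rightarrow> real) \<Rightarrow> int list set \<Rightarrow> (int list \<Rightarrow> real^'n)
    \<Rightarrow> (int list \<Rightarrow> real^'n) \<Rightarrow> (int list \<Rightarrow> real) \<Rightarrow> bool" where
  "isotropic_data B D M v c \<longleftrightarrow>
     (\<forall>i\<in>D. B (v i) (v i) = 0 \<and> B (v i) (M i) = 0 \<and> wedge (v i) (M i) \<noteq> 0 \<and> c i \<noteq> 0) \<and>
     (\<forall>i j. edge D i j \<longrightarrow> v i + v j = c j *\<^sub>R M i + c i *\<^sub>R M j)"

locale isotropic_pair = symmetric_form B for B :: "real^'n \<Rightarrow> real^'n \<Rightarrow> real" +
  fixes D M v c
  assumes net: "moutard_net B D M"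
    and finite_labels: "edge D i j \<Longrightarrow> B (M i) (M j) \<noteq> 0"
    and data: "isotropic_data B D M v c"
begin

abbreviation M' :: "int list \<Rightarrow> real^'n" where
  "M' \<equiv> \<lambda>i. v i /\<^sub>R c i"

lemma v_null: "i \<in> D \<Longrightarrow> B (v i) (v i) = 0"
  and v_perp: "i \<in> D \<Longrightarrow> B (v i) (M i) = 0"
  and v_wedge: "i \<in> D \<Longrightarrow> wedge (v i) (M i) \<noteq> 0"
  and c_nonzero: "i \<in> D \<Longrightarrow> c i \<noteq> 0"
  and v_edge: "edge D i j \<Longrightarrow> v j = c j *\<^sub>R M i + c i *\<^sub>R M j - v i"
  using data unfolding isotropic_data_def by (auto simp: eq_diff_eq add.commute)

lemma form_v_M:
  assumes "edge D i j"
  shows "B (v i) (M j) = c j * B (M i) (M j)"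
proof -
  have "v i = c j *\<^sub>R M i + c i *\<^sub>R M j - v j"
    using v_edge[OF edge_sym[OF assms]] by (simp add: algebra_simps)
  then show ?thesis
    using v_perp moutard_net_null[OF net] edge_in_domain[OF assms] by (simp add: form_simps)
qed

lemma form_v_v:
  assumes "edge D i j"
  shows "B (v i) (v j) = c i * c j * B (M i) (M j)"
  unfolding v_edge[OF assms]
  using form_v_M[OF assms] v_perp v_null edge_in_domain[OF assms] by (simp add: form_simps)

lemma form_M': "edge D i j \<Longrightarrow> B (M' i) (M' j) = B (M i) (M j)"
  using form_v_v c_nonzero edge_in_domain by (simp add: form_simps field_simps)

text \<open>Reaching \<open>v k\<close> through \<open>j\<close> and through \<open>l\<close> gives two expressions for it; comparing them yields
  the relation between the values of \<open>c\<close> on the two diagonals that is dual to the Moutard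
  equation for \<open>M\<close>. Together they evaluate \<open>B (v i) (v k)\<close>.\<close>

lemma form_v_v_diagonal:
  assumes q: "quad D i j k l"
  shows "B (v i) (v k) = c j * c l * B (M i) (M k)"
proof -
  have dom: "i \<in> D" "j \<in> D" "k \<in> D" "l \<in> D" using quad_in_domain[OF q] by auto
  have edges: "edge D i j" "edge D j k" "edge D i l" "edge D l k"
    using q quad_edge quad_rotate quad_reflect by blast+
  have mq: "moutard_quad B (M i) (M j) (M k) (M l)" by (rule moutard_net_quad[OF net q])
  obtain r where r: "M k = M i + r *\<^sub>R (M j - M l)"
    using moutard_coefficient[OF mq] moutard_net_null[OF net] dom by metis
  have vk: "v k = c j *\<^sub>R (M k - M i) + (c k - c i) *\<^sub>R M j + v i"
    unfolding v_edge[OF edges(2)] unfolding v_edge[OF edges(1)] by (simp add: algebra_simps)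
  have vk': "v k = c l *\<^sub>R (M k - M i) + (c k - c i) *\<^sub>R M l + v i"
    unfolding v_edge[OF edges(4)] unfolding v_edge[OF edges(3)] by (simp add: algebra_simps)
  have "(r * (c j - c l) + (c k - c i)) *\<^sub>R (M j - M l) = 0"
    using vk vk' r by (simp add: algebra_simps)
  moreover have "M j \<noteq> M l"
    using mq moutard_net_null[OF net] dom unfolding moutard_quad_def by metis
  ultimately have ck: "c k - c i = - r * (c j - c l)"
    by (simp add: eq_neg_iff_add_eq_0 add.commute)
  have "B (v i) (M k) = r * (c j * B (M i) (M j) - c l * B (M i) (M l))"
    unfolding r using form_v_M[OF edges(1)] form_v_M[OF edges(3)] v_perp dom
    by (simp add: form_simps)
  then have "B (v i) (v k) = c j * c l * (r * (B (M i) (M j) - B (M i) (M l)))"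
  proof -
    assume vM: "B (v i) (M k) = r * (c j * B (M i) (M j) - c l * B (M i) (M l))"
    have "B (v i) (v k) = c j * B (v i) (M k) + (c k - c i) * (c j * B (M i) (M j))"
      unfolding vk using form_v_M[OF edges(1)] v_perp v_null dom by (simp add: form_simps)
    then show ?thesis unfolding vM ck by (simp add: algebra_simps)
  qed
  also have "r * (B (M i) (M j) - B (M i) (M l)) = B (M i) (M k)"
    unfolding r using moutard_net_null[OF net] dom by (simp add: form_simps)
  finally show ?thesis .
qed

text \<open>The 1-forms of the two nets differ by the differential of \<open>i \<mapsto> wedge (M' i) (M i)\<close>. This gives
  closedness on all squares of the cylinder; if both nets lie in a Legendre map, it also places
  them in the same class of 1-forms.\<close>

lemma wedge_M':
  assumes e: "edge D i j"
  shows "wedge (M' j) (M' i) = wedge (M j) (M i) + (wedge (M' j) (M j) - wedge (M' i) (M i))"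
proof -
  have c: "c i \<noteq> 0" "c j \<noteq> 0" using c_nonzero edge_in_domain[OF e] by auto
  have "wedge (v j) (v i) = (c i * c j) *\<^sub>R wedge (M j) (M i) + (c i *\<^sub>R wedge (v j) (M j) - c j *\<^sub>R wedge (v i) (M i))"
    unfolding v_edge[OF e] using wedge_swap[of "M i" "v i"] wedge_swap[of "M j" "v i"]
      wedge_swap[of "M j" "M i"]
    by (simp add: wedge_simps algebra_simps)
  from arg_cong[OF this, of "\<lambda>w. inverse (c i * c j) *\<^sub>R w"] show ?thesis
    using c by (simp add: wedge_simps scaleR_add_right scaleR_diff_right field_simps)
qed

text \<open>On squares of the upper level all four lifts are pairwise non-orthogonal, which subsumes
  every regularity condition. On a square over an edge, the orthogonal pairs are the vertical
  edges, where \<open>wedge (v i) (M i) \<noteq> 0\<close> takes over.\<close>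

lemma moutard_net_cyl: "moutard_net B (cyl D) (M \<squnion>\<^sub>n M')"
proof -
  have null: "B ((M \<squnion>\<^sub>n M') x) ((M \<squnion>\<^sub>n M') x) = 0" "(M \<squnion>\<^sub>n M') x \<noteq> 0" if "x \<in> cyl D" for x
    using that moutard_net_null[OF net] moutard_net_nonzero[OF net] v_null v_wedge c_nonzero
    by (auto elim!: in_cylE simp: form_simps) (metis wedge_0_left)
  have up: "wedge (M' i) (M i) \<noteq> 0" if "i \<in> D" for i
    using v_wedge c_nonzero that by (simp add: wedge_simps)
  have not_perp: "B (M' i) (M' j) \<noteq> 0" if "edge D i j" for i j
    using form_M'[OF that] finite_labels[OF that] by simp
  have diagonal: "B (M' i) (M' k) \<noteq> 0" if q: "quad D i j k l" for i j k l
    using form_v_v_diagonal[OF q] moutard_net_quad[OF net q] c_nonzero quad_in_domain[OF q]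
    by (simp add: form_simps moutard_quad_def)
  show ?thesis
    unfolding moutard_net_def
  proof (intro conjI ballI allI impI null)
    fix x y assume "edge (cyl D) x y"
    then show "wedge ((M \<squnion>\<^sub>n M') y) ((M \<squnion>\<^sub>n M') x) \<noteq> 0"
    proof (cases rule: edge_cyl_cases)
      case (level b i j)
      have "wedge (M' j) (M' i) \<noteq> 0"
        using level null[of "1 # j"] edge_in_domain not_perp[OF edge_sym]
        by (intro wedge_nonzero_if_not_orthogonal) auto
      then show ?thesis
        using level moutard_net_edge[OF net] by auto
    next
      case (up i)
      then show ?thesis using \<open>\<And>i. i \<in> D \<Longrightarrow> wedge (M' i) (M i) \<noteq> 0\<close> by simp
    next
      case (down i)
      then show ?thesis using up[of i] wedge_swap[of "M i" "M' i"] by simp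
    qed
  next
    fix x y z w assume "quad (cyl D) x y z w"
    then show "moutard_quad B ((M \<squnion>\<^sub>n M') x) ((M \<squnion>\<^sub>n M') y) ((M \<squnion>\<^sub>n M') z) ((M \<squnion>\<^sub>n M') w)"
    proof (induction rule: quad_cyl_induct)
      case (level b i j k l)
      note q = \<open>quad D i j k l\<close>
      have dom: "i \<in> D" "j \<in> D" "k \<in> D" "l \<in> D" using quad_in_domain[OF q] by auto
      have edges: "edge D i j" "edge D j k" "edge D k l" "edge D l i"
        using q quad_edge quad_rotate by blast+
      have "wedge (M' i - M' k) (M' l - M' j) = 0"
        using moutard_net_quad[OF net q]
        unfolding wedge_diff_cycle moutard_quad_def edges[THEN wedge_M'] by (simp add: add.assoc)
      moreover have "dim {M' i, M' j, M' k, M' l} \<ge> 3"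
      proof (rule dim_ge_3[of "M' i" "M' j" "M' k"])
        fix x y z assume "x *\<^sub>R M' i + y *\<^sub>R M' j + z *\<^sub>R M' k = 0"
        then show "x = 0 \<and> y = 0 \<and> z = 0"
          using null[of "1 # i"] null[of "1 # j"] null[of "1 # k"] dom
          by (intro independent_if_not_orthogonal[OF _ _ _ not_perp[OF edges(1)]
                not_perp[OF edges(2)] diagonal[OF q]]) auto
      qed auto
      ultimately have "moutard_quad B (M' i) (M' j) (M' k) (M' l)"
        using diagonal[OF q] diagonal[OF quad_rotate[OF q]] unfolding moutard_quad_def by blast
      then show ?case using moutard_net_quad[OF net q] by simp
    next
      case (vertical i j)
      note dom = edge_in_domain[OF vertical]
      have 1: "B (M i) (M' j) \<noteq> 0" "B (M j) (M' i) \<noteq> 0"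
        using form_v_M[OF vertical] form_v_M[OF edge_sym[OF vertical]] finite_labels[OF vertical]
          finite_labels[OF edge_sym[OF vertical]] c_nonzero dom
        by (simp_all add: form_simps sym[of _ "v _"])
      have 2: "wedge (M i - M' j) (M' i - M j) = 0"
        using wedge_M'[OF vertical] wedge_swap[of "M' i" "M i"] wedge_swap[of "M' i" "M' j"]
        by (simp add: wedge_diff_cycle)
      have 3: "x = 0 \<and> y = 0 \<and> z = 0" if rel: "x *\<^sub>R M i + y *\<^sub>R M j + z *\<^sub>R M' j = 0" for x y z
      proof -
        have "B (M j) (x *\<^sub>R M i + y *\<^sub>R M j + z *\<^sub>R M' j) = 0"
          by (simp only: rel form_simps)
        then have x: "x = 0"
          using finite_labels[OF edge_sym[OF vertical]] moutard_net_null[OF net] v_perp dom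
          by (simp add: form_simps sym[of "M j" "v j"])
        then have "wedge (y *\<^sub>R M j + z *\<^sub>R M' j) (M j) = 0" using rel by simp
        then have z: "z = 0" using up[OF dom(2)] by (simp add: wedge_simps)
        show ?thesis using rel x z moutard_net_nonzero[OF net dom(2)] by simp
      qed
      have "dim {M i, M j, M' j, M' i} \<ge> 3"
        by (rule dim_ge_3[of "M i" "M j" "M' j"]) (use 3 in auto)
      then show ?case using 1 2 by (simp add: moutard_quad_def)
    next
      case (rotate x y z w)
      then show ?case by (rule moutard_quad_sym)
    next
      case (reflect x y z w)
      then show ?case by (rule moutard_quad_sym)
    qed
  qed
qed

end

section \<open>Parallel transport over a simply connected domain\<close>

fun transport :: "('p \<Rightarrow> 'p \<Rightarrow> 'a \<Rightarrow> 'a) \<Rightarrow> 'p list \<Rightarrow> 'a \<Rightarrow> 'a" where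
  "transport \<Gamma> (i # j # P) x = transport \<Gamma> (j # P) (\<Gamma> i j x)"
| "transport \<Gamma> [i] x = x"
| "transport \<Gamma> [] x = x"

lemma transport_append:
  "transport \<Gamma> (P @ i # Q) x = transport \<Gamma> (i # Q) (transport \<Gamma> (P @ [i]) x)"
proof (induction P arbitrary: x)
  case (Cons p P)
  then show ?case by (cases P) auto
qed simp

lemma linear_transport:
  assumes "\<And>i j. linear (\<Gamma> i j)"
  shows "linear (transport \<Gamma> P)"
proof (induction P rule: induct_list012)
  case (3 i j P)
  have "linear (transport \<Gamma> (j # P) \<circ> \<Gamma> i j)"
    using assms 3 by (intro linear_compose)
  then show ?case by (simp add: o_def fun_eq_iff)
qed (simp_all add: linear_iff)

lemma edge_path_append:
  "edge_path \<Sigma> (P @ i # Q) \<longleftrightarrow> edge_path \<Sigma> (P @ [i]) \<and> edge_path \<Sigma> (i # Q)"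
  by (cases P rule: rev_cases) (auto simp: edge_path_def successively_append_iff)

lemma edge_path_Cons: "edge_path \<Sigma> (i # j # P) \<longleftrightarrow> edge \<Sigma> i j \<and> edge_path \<Sigma> (j # P)"
  using edge_in_domain by (auto simp: edge_path_def)

lemma edge_path_rev: "edge_path \<Sigma> P \<Longrightarrow> edge_path \<Sigma> (rev P)"
  using edge_sym by (auto simp: edge_path_def successively_rev elim: successively_mono)

text \<open>The fibres \<open>E i\<close> are subsets of one type, on which the connection is given by total maps; its
  laws hold on the fibres.\<close>

locale flat_connection =
  fixes \<Sigma> :: "int list set" and \<Gamma> :: "int list \<Rightarrow> int list \<Rightarrow> 'a \<Rightarrow> 'a" and E :: "int list \<Rightarrow> 'a set"
  assumes step_into: "edge \<Sigma> i j \<Longrightarrow> x \<in> E i \<Longrightarrow> \<Gamma> i j x \<in> E j"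
    and step_back: "edge \<Sigma> i j \<Longrightarrow> x \<in> E i \<Longrightarrow> \<Gamma> j i (\<Gamma> i j x) = x"
    and flat: "quad \<Sigma> i j k l \<Longrightarrow> x \<in> E i \<Longrightarrow> \<Gamma> j k (\<Gamma> i j x) = \<Gamma> l k (\<Gamma> i l x)"
begin

lemma transport_into: "edge_path \<Sigma> P \<Longrightarrow> x \<in> E (hd P) \<Longrightarrow> transport \<Gamma> P x \<in> E (last P)"
proof (induction P arbitrary: x rule: induct_list012)
  case (3 i j P)
  then have "edge \<Sigma> i j" "edge_path \<Sigma> (j # P)" by (auto simp: edge_path_Cons)
  then show ?case using 3 step_into by simp
qed (simp_all add: edge_path_def)

lemma transport_rev:
  "edge_path \<Sigma> P \<Longrightarrow> x \<in> E (hd P) \<Longrightarrow> transport \<Gamma> (rev P) (transport \<Gamma> P x) = x"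
proof (induction P arbitrary: x rule: induct_list012)
  case (3 i j P)
  then have "edge \<Sigma> i j" "edge_path \<Sigma> (j # P)" by (auto simp: edge_path_Cons)
  then show ?case
    using 3 step_into step_back by (simp add: transport_append[of \<Gamma> "rev P" j "[i]"])
qed auto

text \<open>Backtracking is undone by \<open>step_back\<close>, and exchanging two sides of a square by \<open>flat\<close>.\<close>

lemma path_move_invariant:
  assumes "path_move \<Sigma> P Q"
  shows "edge_path \<Sigma> P \<longleftrightarrow> edge_path \<Sigma> Q" "hd P = hd Q"
    and "edge_path \<Sigma> P \<Longrightarrow> x \<in> E (hd P) \<Longrightarrow> transport \<Gamma> P x = transport \<Gamma> Q x"
proof -
  have "(edge_path \<Sigma> P \<longleftrightarrow> edge_path \<Sigma> Q) \<and> hd P = hd Q \<and>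
    (edge_path \<Sigma> P \<longrightarrow> x \<in> E (hd P) \<longrightarrow> transport \<Gamma> P x = transport \<Gamma> Q x)"
    using assms
  proof cases
    case (backtrack i j R S)
    then have *: "edge \<Sigma> i j" "edge \<Sigma> j i" by (auto intro: edge_sym)
    have path: "edge_path \<Sigma> P \<longleftrightarrow> edge_path \<Sigma> (R @ [i]) \<and> edge_path \<Sigma> (i # S)"
      "edge_path \<Sigma> Q \<longleftrightarrow> edge_path \<Sigma> (R @ [i]) \<and> edge_path \<Sigma> (i # S)"
      using * unfolding backtrack
      by (simp_all add: edge_path_append[of _ R i S] edge_path_append[of _ R i "j # i # S"] edge_path_Cons)
    have hd: "hd P = hd (R @ [i])" "hd Q = hd (R @ [i])"
      unfolding backtrack by (cases R; simp)+
    have "transport \<Gamma> P x = transport \<Gamma> Q x" if "edge_path \<Sigma> P" "x \<in> E (hd P)"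
    proof -
      have "transport \<Gamma> (R @ [i]) x \<in> E i"
        using that transport_into[of "R @ [i]" x] path hd by simp
      then show ?thesis
        unfolding backtrack
        by (simp add: transport_append[of \<Gamma> R i S] transport_append[of \<Gamma> R i "j # i # S"] step_back *)
    qed
    then show ?thesis using path hd by simp
  next
    case (flip i j k l R S)
    have q: "quad \<Sigma> k l i j" by (intro quad_rotate[OF quad_rotate[OF flip(3)]])
    have *: "edge \<Sigma> k l" "edge \<Sigma> l i" "edge \<Sigma> k j" "edge \<Sigma> j i"
      using quad_edge[OF q] quad_edge[OF quad_rotate[OF q]] quad_edge[OF quad_reflect[OF q]]
        quad_edge[OF quad_rotate[OF quad_reflect[OF q]]] by auto
    have path: "edge_path \<Sigma> P \<longleftrightarrow> edge_path \<Sigma> (R @ [k]) \<and> edge_path \<Sigma> (i # S)"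
      "edge_path \<Sigma> Q \<longleftrightarrow> edge_path \<Sigma> (R @ [k]) \<and> edge_path \<Sigma> (i # S)"
      using * unfolding flip(1,2)
      by (simp_all add: edge_path_append[of _ R k "l # i # S"] edge_path_append[of _ R k "j # i # S"] edge_path_Cons)
    have hd: "hd P = hd (R @ [k])" "hd Q = hd (R @ [k])"
      unfolding flip(1,2) by (cases R; simp)+
    have "transport \<Gamma> P x = transport \<Gamma> Q x" if "edge_path \<Sigma> P" "x \<in> E (hd P)"
    proof -
      have "transport \<Gamma> (R @ [k]) x \<in> E k"
        using that transport_into[of "R @ [k]" x] path hd by simp
      then show ?thesis
        unfolding flip(1,2)
        by (simp add: transport_append[of \<Gamma> R k "l # i # S"] transport_append[of \<Gamma> R k "j # i # S"] flat[OF q])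
    qed
    then show ?thesis using path hd by simp
  qed
  then show "edge_path \<Sigma> P \<longleftrightarrow> edge_path \<Sigma> Q" "hd P = hd Q"
    "edge_path \<Sigma> P \<Longrightarrow> x \<in> E (hd P) \<Longrightarrow> transport \<Gamma> P x = transport \<Gamma> Q x"
    by auto
qed

lemma transport_homotopic:
  assumes "equivclp (path_move \<Sigma>) P Q" "edge_path \<Sigma> P" "x \<in> E (hd P)"
  shows "transport \<Gamma> P x = transport \<Gamma> Q x"
proof -
  have "edge_path \<Sigma> Q \<and> hd Q = hd P \<and> transport \<Gamma> P x = transport \<Gamma> Q x"
    using assms
  proof (induction rule: equivclp_induct)
    case (step Q R)
    then show ?case
      using path_move_invariant(1,2)[of Q R] path_move_invariant(1,2)[of R Q]
        path_move_invariant(3)[of Q R x] path_move_invariant(3)[of R Q x] by auto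
  qed simp
  then show ?thesis by simp
qed

text \<open>For \<open>x\<close> in the fibre over the base point, \<open>\<lambda>i. transport \<Gamma> (path i) x\<close> is the parallel section
  through \<open>x\<close>. The last clause, by transport along the reversed path, says that the value may be
  prescribed at any other point instead.\<close>

lemma parallel_sections:
  assumes sc: "simply_connected_domain \<Sigma>" and i0: "i0 \<in> \<Sigma>"
  obtains path where "\<And>i x. i \<in> \<Sigma> \<Longrightarrow> x \<in> E i0 \<Longrightarrow> transport \<Gamma> (path i) x \<in> E i"
    and "\<And>i j x. edge \<Sigma> i j \<Longrightarrow> x \<in> E i0 \<Longrightarrow>
      transport \<Gamma> (path j) x = \<Gamma> i j (transport \<Gamma> (path i) x)"
    and "\<And>i y. i \<in> \<Sigma> \<Longrightarrow> y \<in> E i \<Longrightarrow> \<exists>x\<in>E i0. transport \<Gamma> (path i) x = y"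
proof -
  obtain path where path: "\<And>i. i \<in> \<Sigma> \<Longrightarrow> edge_path \<Sigma> (path i) \<and> hd (path i) = i0 \<and> last (path i) = i"
    using sc i0 unfolding simply_connected_domain_def by metis
  show thesis
  proof (rule that[of path])
    show "transport \<Gamma> (path i) x \<in> E i" if "i \<in> \<Sigma>" "x \<in> E i0" for i x
      using path[OF that(1)] transport_into that(2) by metis
    show "transport \<Gamma> (path j) x = \<Gamma> i j (transport \<Gamma> (path i) x)" if "edge \<Sigma> i j" "x \<in> E i0" for i j x
    proof -
      have ij: "i \<in> \<Sigma>" "j \<in> \<Sigma>" using edge_in_domain[OF that(1)] by auto
      obtain R where R: "path i = R @ [i]"
        using path[OF ij(1)] by (metis append_butlast_last_id edge_path_def)
      have "edge_path \<Sigma> (R @ [i, j])" "hd (R @ [i, j]) = i0" "last (R @ [i, j]) = j"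
        using path[OF ij(1)] that(1) ij unfolding R
        by (auto simp: edge_path_append[of _ R i "[j]"] edge_path_Cons hd_append)
          (auto simp: edge_path_def)
      then have "equivclp (path_move \<Sigma>) (path j) (R @ [i, j])"
        using sc path[OF ij(2)] unfolding simply_connected_domain_def by metis
      then have "transport \<Gamma> (path j) x = transport \<Gamma> (R @ [i, j]) x"
        using path[OF ij(2)] that(2) by (intro transport_homotopic) auto
      then show ?thesis unfolding R by (simp add: transport_append[of \<Gamma> R i "[j]"])
    qed
    show "\<exists>x\<in>E i0. transport \<Gamma> (path i) x = y" if "i \<in> \<Sigma>" "y \<in> E i" for i y
    proof
      have *: "edge_path \<Sigma> (rev (path i))" "hd (rev (path i)) = i" "last (rev (path i)) = i0"
        using path[OF that(1)] edge_path_rev by (auto simp: hd_rev last_rev)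
      show "transport \<Gamma> (rev (path i)) y \<in> E i0" using transport_into[OF *(1)] * that by simp
      show "transport \<Gamma> (path i) (transport \<Gamma> (rev (path i)) y) = y"
        using transport_rev[OF *(1)] * that by simp
    qed
  qed
qed

end

text \<open>Baire's theorem in \<open>E\<close>: the complement of a proper subspace is open and dense.\<close>

lemma avoid_countably_many_subspaces:
  fixes E :: "'a::euclidean_space set"
  assumes E: "subspace E" and K: "countable K"
    and sub: "\<And>T. T \<in> K \<Longrightarrow> subspace T" and ne: "\<And>T. T \<in> K \<Longrightarrow> \<not> E \<subseteq> T"
  obtains x where "x \<in> E" "\<And>T. T \<in> K \<Longrightarrow> x \<notin> T"
proof (cases "K = {}")
  case True
  then show ?thesis using that[of 0] E by (simp add: subspace_0)
next
  case False
  have "E \<subseteq> closure (\<Inter>((\<lambda>T. E - T) ` K))"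
  proof (rule Baire)
    show "closed E" using E by (rule closed_subspace)
    show "countable ((\<lambda>T. E - T) ` K)" using K by simp
    fix U assume "U \<in> (\<lambda>T. E - T) ` K"
    then obtain T where T: "T \<in> K" "U = E - T" by auto
    obtain y where y: "y \<in> E" "y \<notin> T" using ne[OF T(1)] by auto
    have "openin (top_of_set E) U"
      unfolding T(2) using closed_subspace[OF sub[OF T(1)]]
      by (simp add: openin_open_Int Diff_eq open_Compl)
    moreover have "E \<subseteq> closure U"
    proof
      fix x assume x: "x \<in> E"
      show "x \<in> closure U"
      proof (cases "x \<in> T")
        case False
        then show ?thesis using x T(2) closure_subset[of U] by auto
      next
        case True
        have y0: "y \<noteq> 0" using y sub[OF T(1)] subspace_0 by auto
        show ?thesis
          unfolding closure_approachable
        proof (intro allI impI)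
          fix e :: real assume "e > 0"
          define r where "r = e / (2 * norm y)"
          have r: "r > 0" using \<open>e > 0\<close> y0 by (simp add: r_def)
          have "x + r *\<^sub>R y \<in> E" using E x y by (simp add: subspace_add subspace_scale)
          moreover have "x + r *\<^sub>R y \<notin> T"
          proof
            assume "x + r *\<^sub>R y \<in> T"
            then have "(x + r *\<^sub>R y) - x \<in> T" using True sub[OF T(1)] subspace_diff by blast
            then have "r *\<^sub>R y \<in> T" by simp
            from subspace_scale[OF sub[OF T(1)] this, of "inverse r"] show False using r y by simp
          qed
          moreover have "dist (x + r *\<^sub>R y) x < e"
            using \<open>e > 0\<close> y0 by (simp add: r_def dist_norm)
          ultimately show "\<exists>z\<in>U. dist z x < e" using T by blast
        qed
      qed
    qed
    ultimately show "openin (top_of_set E) U \<and> E \<subseteq> closure U" by simp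
  qed
  then have "\<Inter>((\<lambda>T. E - T) ` K) \<noteq> {}"
    using subspace_0[OF E] by (metis closure_empty empty_iff subsetD)
  then show thesis using that False by blast
qed

section \<open>Isothermic nets in a Legendre map\<close>

text \<open>An isothermic net inside a Legendre map, given by its lift. Transversality, that is
  \<open>M i \<notin> f i \<inter> f j\<close>, makes \<open>M i\<close> and the common vector of \<open>f i\<close> and \<open>f j\<close> a basis of \<open>f i\<close>.\<close>

locale enveloping = symmetric_form B for B :: "real^'n \<Rightarrow> real^'n \<Rightarrow> real" +
  fixes D f M
  assumes legendre: "legendre_map B D f"
    and net: "moutard_net B D M"
    and M_in: "i \<in> D \<Longrightarrow> M i \<in> f i"
    and transversal: "edge D i j \<Longrightarrow> M i \<notin> f j"
begin

lemma plane: "i \<in> D \<Longrightarrow> subspace (f i)" "i \<in> D \<Longrightarrow> dim (f i) = 2"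
    "i \<in> D \<Longrightarrow> x \<in> f i \<Longrightarrow> y \<in> f i \<Longrightarrow> B x y = 0"
  using legendre unfolding legendre_map_def null_planes_def by auto

lemma common_vector:
  assumes "edge D i j"
  obtains \<sigma> where "\<sigma> \<noteq> 0" "\<sigma> \<in> f i" "\<sigma> \<in> f j" "f i = span {M i, \<sigma>}" "f j = span {M j, \<sigma>}"
proof -
  note dom = edge_in_domain[OF assms]
  have "f i \<inter> f j \<noteq> {0}" using legendre assms unfolding legendre_map_def by auto
  moreover have "0 \<in> f i \<inter> f j" using plane(1) dom subspace_0 by auto
  ultimately obtain \<sigma> where \<sigma>: "\<sigma> \<noteq> 0" "\<sigma> \<in> f i" "\<sigma> \<in> f j" by blast
  have "wedge (M a) \<sigma> \<noteq> 0" if "edge D a b" "\<sigma> \<in> f b" for a b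
  proof
    assume "wedge (M a) \<sigma> = 0"
    then have "wedge \<sigma> (M a) = 0" using wedge_swap[of \<sigma> "M a"] by simp
    then obtain r where "M a = r *\<^sub>R \<sigma>" using \<sigma>(1) wedge_eq_0_collinear by blast
    then have "M a \<in> f b"
      using \<open>\<sigma> \<in> f b\<close> plane(1) edge_in_domain[OF that(1)] by (simp add: subspace_scale)
    then show False using transversal[OF that(1)] by simp
  qed
  then show thesis
    using \<sigma> plane M_in dom assms edge_sym[OF assms]
    by (intro that[of \<sigma>] plane_eq_span) auto
qed

end

text \<open>Parallel sections are the solutions \<open>(v, c)\<close> of \<open>v i + v j = c j *\<^sub>R M i + c i *\<^sub>R M j\<close> with
  \<open>v i - c j *\<^sub>R M i\<close> in \<open>f i \<inter> f j\<close>. That intersection is orthogonal to \<open>M j\<close>, which determines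
  \<open>c j\<close> as the quotient below.\<close>

definition moutard_connection ::
  "(real^'n \<Rightarrow> real^'n \<Rightarrow> real) \<Rightarrow> (int list \<Rightarrow> real^'n) \<Rightarrow> int list \<Rightarrow> int list
    \<Rightarrow> (real^'n) \<times> real \<Rightarrow> (real^'n) \<times> real" where
  "moutard_connection B M i j x =
     (snd x *\<^sub>R M j + (B (fst x) (M j) / B (M i) (M j)) *\<^sub>R M i - fst x, B (fst x) (M j) / B (M i) (M j))"

context symmetric_form
begin

lemma linear_moutard_connection: "linear (moutard_connection B M i j)"
  by (rule linearI)
    (simp_all add: moutard_connection_def form_simps algebra_simps add_divide_distrib)

text \<open>Along either side of the square the new scalar is \<open>g + r * (b - a)\<close>, where \<open>g\<close> is the initial
  scalar and \<open>a\<close>, \<open>b\<close> are the scalars at \<open>j\<close> and \<open>l\<close>. The new vectors then agree by the Moutard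
  equation for \<open>M\<close>.\<close>

lemma moutard_connection_flat:
  assumes null: "B (M i) (M i) = 0" "B (M j) (M j) = 0" "B (M k) (M k) = 0" "B (M l) (M l) = 0"
    and r: "M k = M i + r *\<^sub>R (M j - M l)" "r \<noteq> 0"
    and fin: "B (M i) (M j) \<noteq> 0" "B (M i) (M l) \<noteq> 0"
    and perp: "B (fst x) (M i) = 0"
  shows "moutard_connection B M j k (moutard_connection B M i j x) =
    moutard_connection B M l k (moutard_connection B M i l x)"
proof -
  obtain v g where x: "x = (v, g)" by (cases x)
  define a where "a = B v (M j) / B (M i) (M j)"
  define b where "b = B v (M l) / B (M i) (M l)"
  have jk: "B (M j) (M k) = B (M i) (M l)"
    using opposite_edges[OF r] null by simp
  have lk: "B (M l) (M k) = B (M i) (M j)"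
    using opposite_edges[of "M k" "M i" "- r" "M l" "M j"] r null sym[of "M i" "M j"]
    by (simp add: scaleR_diff_right)
  have vk: "B v (M k) = r * (a * B (M i) (M j) - b * B (M i) (M l))"
    unfolding r(1) a_def b_def using perp fin x by (simp add: form_simps)
  have ik: "B (M i) (M k) = r * (B (M i) (M j) - B (M i) (M l))"
    unfolding r(1) using null by (simp add: form_simps)
  have c1: "B (g *\<^sub>R M j + a *\<^sub>R M i - v) (M k) / B (M j) (M k) = g + r * (b - a)"
    using fin by (simp add: form_simps vk ik jk field_simps)
  have c2: "B (g *\<^sub>R M l + b *\<^sub>R M i - v) (M k) / B (M l) (M k) = g + r * (b - a)"
    using fin by (simp add: form_simps vk ik lk field_simps)
  have "a *\<^sub>R M k + (g + r * (b - a)) *\<^sub>R M j - (g *\<^sub>R M j + a *\<^sub>R M i - v) =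
    b *\<^sub>R M k + (g + r * (b - a)) *\<^sub>R M l - (g *\<^sub>R M l + b *\<^sub>R M i - v)"
    unfolding r(1) by (simp add: algebra_simps)
  then show ?thesis
    unfolding moutard_connection_def x fst_conv snd_conv a_def[symmetric] b_def[symmetric] c1 c2
    by simp
qed

end

context enveloping
begin

lemma flat_connection_moutard:
  assumes fin: "\<And>i j. edge D i j \<Longrightarrow> B (M i) (M j) \<noteq> 0"
  shows "flat_connection D (moutard_connection B M) (\<lambda>i. f i \<times> UNIV)"
proof
  fix i j x assume e: "edge D i j" and x: "x \<in> f i \<times> (UNIV :: real set)"
  note dom = edge_in_domain[OF e]
  obtain v g where vg: "x = (v, g)" "v \<in> f i" using x by auto
  define a where "a = B v (M j) / B (M i) (M j)"
  obtain \<sigma> where \<sigma>: "\<sigma> \<in> f i" "\<sigma> \<in> f j" "f i = span {M i, \<sigma>}"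
    using common_vector[OF e] by metis
  obtain p q where v: "v = p *\<^sub>R M i + q *\<^sub>R \<sigma>"
    using vg(2) unfolding \<sigma>(3) by (rule in_span_pairE)
  have "a = p"
    unfolding a_def v using fin[OF e] plane(3)[OF dom(2) \<sigma>(2) M_in[OF dom(2)]] by (simp add: form_simps)
  then have step: "moutard_connection B M i j x = (g *\<^sub>R M j - q *\<^sub>R \<sigma>, p)"
    unfolding moutard_connection_def vg a_def by (simp add: v)
  show "moutard_connection B M i j x \<in> f j \<times> UNIV"
    unfolding step using plane(1)[OF dom(2)] \<sigma>(2) M_in[OF dom(2)]
    by (simp add: subspace_diff subspace_scale)
  have "B (g *\<^sub>R M j - q *\<^sub>R \<sigma>) (M i) / B (M j) (M i) = g"
    using fin[OF edge_sym[OF e]] plane(3)[OF dom(1) \<sigma>(1) M_in[OF dom(1)]] by (simp add: form_simps)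
  then show "moutard_connection B M j i (moutard_connection B M i j x) = x"
    unfolding step unfolding moutard_connection_def by (simp add: vg v)
next
  fix i j k l x assume q: "quad D i j k l" and x: "x \<in> f i \<times> (UNIV :: real set)"
  have dom: "i \<in> D" "j \<in> D" "k \<in> D" "l \<in> D" using quad_in_domain[OF q] by auto
  obtain r where r: "r \<noteq> 0" "M k = M i + r *\<^sub>R (M j - M l)"
    using moutard_coefficient[OF moutard_net_quad[OF net q]] moutard_net_null[OF net] dom by metis
  show "moutard_connection B M j k (moutard_connection B M i j x) =
      moutard_connection B M l k (moutard_connection B M i l x)"
    using x dom plane(3)[of i] M_in[of i]
    by (intro moutard_connection_flat[OF moutard_net_null[OF net] moutard_net_null[OF net]
          moutard_net_null[OF net] moutard_net_null[OF net] r(2) r(1)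
          fin[OF quad_edge[OF q]] fin[OF quad_edge[OF quad_reflect[OF q]]]]) (auto simp: mem_Times_iff)
qed

text \<open>The vectors \<open>h i\<close> allow for one more genericity condition at each point. For a parallel section
  \<open>(v, c)\<close> the three conditions at \<open>i\<close> exclude a proper subspace each, since its value at \<open>i\<close> can be
  prescribed.\<close>

lemma isotropic_data_exists:
  assumes sc: "simply_connected_domain D" and cnt: "countable D"
    and fin: "\<And>i j. edge D i j \<Longrightarrow> B (M i) (M j) \<noteq> 0"
    and h: "\<And>i. i \<in> D \<Longrightarrow> B (M i) (h i) \<noteq> 0"
  obtains v c where "isotropic_data B D M v c" "\<And>i. i \<in> D \<Longrightarrow> v i \<in> f i"
    "\<And>i. i \<in> D \<Longrightarrow> B (v i) (h i) \<noteq> 0"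
proof (cases "D = {}")
  case True
  then show ?thesis using that by (auto simp: isotropic_data_def edge_def)
next
  case False
  then obtain i0 where i0: "i0 \<in> D" by auto
  define E where "E = (\<lambda>i. f i \<times> (UNIV :: real set))"
  interpret flat_connection D "moutard_connection B M" E
    unfolding E_def using fin by (rule flat_connection_moutard)
  obtain path where path:
    "\<And>i x. i \<in> D \<Longrightarrow> x \<in> E i0 \<Longrightarrow> transport (moutard_connection B M) (path i) x \<in> E i"
    "\<And>i j x. edge D i j \<Longrightarrow> x \<in> E i0 \<Longrightarrow> transport (moutard_connection B M) (path j) x =
      moutard_connection B M i j (transport (moutard_connection B M) (path i) x)"
    "\<And>i y. i \<in> D \<Longrightarrow> y \<in> E i \<Longrightarrow> \<exists>x\<in>E i0. transport (moutard_connection B M) (path i) x = y"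
    using parallel_sections[OF sc i0] by metis
  define T where "T = (\<lambda>i. transport (moutard_connection B M) (path i))"
  have T: "\<And>i. linear (T i)" "\<And>i x. i \<in> D \<Longrightarrow> x \<in> E i0 \<Longrightarrow> T i x \<in> E i"
    "\<And>i j x. edge D i j \<Longrightarrow> x \<in> E i0 \<Longrightarrow> T j x = moutard_connection B M i j (T i x)"
    "\<And>i y. i \<in> D \<Longrightarrow> y \<in> E i \<Longrightarrow> \<exists>x\<in>E i0. T i x = y"
    using path linear_transport[OF linear_moutard_connection] unfolding T_def by auto
  \<comment> \<open>the values at a point that violate one of the three conditions\<close>
  define bad where "bad = (\<lambda>i. {UNIV \<times> {0}, {v. B v (h i) = 0} \<times> UNIV, span {M i} \<times> (UNIV :: real set)})"
  define K where "K = (\<Union>i\<in>D. (\<lambda>S. T i -` S) ` bad i)"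
  have "countable K" unfolding K_def bad_def using cnt by simp
  moreover have "subspace (E i0)"
    unfolding E_def using plane(1)[OF i0] by (intro subspace_Times) auto
  moreover have "subspace S" if "S \<in> K" for S
  proof -
    have "subspace {v. B v w = 0}" for w
      by (auto simp: subspace_def form_simps)
    then have "subspace S'" if "S' \<in> bad i" for S' i
      using that unfolding bad_def by (auto intro!: subspace_Times subspace_single_0)
    then show ?thesis using that unfolding K_def by (auto intro: linear_subspace_vimage T(1))
  qed
  moreover have "\<not> E i0 \<subseteq> S" if "S \<in> K" for S
  proof -
    obtain i S' where i: "i \<in> D" "S' \<in> bad i" "S = T i -` S'" using \<open>S \<in> K\<close> unfolding K_def by auto
    obtain n where "n \<in> f i" "n \<notin> span {M i}"
      using plane[OF i(1)] plane_not_in_line by metis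
    then have "\<exists>y\<in>E i. y \<notin> S'"
      using i(2) h[OF i(1)] M_in[OF i(1)] subspace_0[OF plane(1)[OF i(1)]]
      unfolding bad_def E_def
      by (auto intro: bexI[of _ "(0, 1)"] bexI[of _ "(M i, 0)"] bexI[of _ "(n, 0)"])
    then show ?thesis using T(4)[OF i(1)] i(3) by (metis in_mono vimageE)
  qed
  \<comment> \<open>\<open>x\<close> is the value at the base point of the section wanted\<close>
  ultimately obtain x where x: "x \<in> E i0" "\<And>S. S \<in> K \<Longrightarrow> x \<notin> S"
    using avoid_countably_many_subspaces by metis
  define v where "v = (\<lambda>i. fst (T i x))"
  define c where "c = (\<lambda>i. snd (T i x))"
  have vc: "T i x = (v i, c i)" for i by (simp add: v_def c_def)
  have good: "c i \<noteq> 0" "B (v i) (h i) \<noteq> 0" "v i \<notin> span {M i}" if "i \<in> D" for i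
    using x(2)[of "T i -` _"] that unfolding K_def bad_def by (auto simp: vc)
  have v_in: "v i \<in> f i" if "i \<in> D" for i
    using T(2)[OF that x(1)] vc by (simp add: E_def)
  have "isotropic_data B D M v c"
    unfolding isotropic_data_def
  proof (intro conjI ballI allI impI)
    fix i assume i: "i \<in> D"
    show "B (v i) (v i) = 0" "B (v i) (M i) = 0" "c i \<noteq> 0"
      using plane(3)[OF i] v_in[OF i] M_in[OF i] good(1)[OF i] by auto
    show "wedge (v i) (M i) \<noteq> 0"
      using good(3)[OF i] moutard_net_nonzero[OF net i] wedge_eq_0_in_span[of "M i" "v i"]
        wedge_swap[of "M i" "v i"] by auto
  next
    fix i j assume e: "edge D i j"
    have "c j = B (v i) (M j) / B (M i) (M j)"
      "v j = c i *\<^sub>R M j + (B (v i) (M j) / B (M i) (M j)) *\<^sub>R M i - v i"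
      using T(3)[OF e x(1)] unfolding vc moutard_connection_def by simp_all
    then show "v i + v j = c j *\<^sub>R M i + c i *\<^sub>R M j" by simp
  qed
  then show thesis using that v_in good by blast
qed

end

context symmetric_form
begin

lemma edge_label_inverse: "m \<noteq> 0 \<Longrightarrow> ereal m = 1 / ereal x \<longleftrightarrow> x = 1 / m"
  by (cases "x = 0") (auto simp: one_ereal_def field_simps)

lemma edge_label_infinity: "\<infinity> = 1 / ereal x \<longleftrightarrow> x = 0"
  by (cases "x = 0") (auto simp: one_ereal_def)

text \<open>Adding sections of \<open>Lambda2 f\<close> to a 1-form does not change its product with \<open>f i \<inter> f j\<close>, so
  by applicability the product of \<open>wedge (M j) (M i)\<close> with some \<open>v \<in> f i \<inter> f j\<close> is nonzero. It would
  vanish if \<open>M i\<close>, \<open>M j\<close> and \<open>v\<close> were all in the plane \<open>f j\<close>.\<close>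

lemma enveloping_isothermic_in:
  assumes app: "applicable B \<Sigma> f \<eta>" and iso: "isothermic_in B \<Sigma> f \<eta> s \<eta>s"
    and lift: "moutard_lift \<Sigma> s \<eta>s M"
  shows "enveloping B \<Sigma> f M"
proof
  show leg: "legendre_map B \<Sigma> f" using app unfolding applicable_def by simp
  have iso': "isothermic B \<Sigma> s \<eta>s" using iso unfolding isothermic_in_def by simp
  show "moutard_net B \<Sigma> M" by (rule isothermic_moutard_net(1)[OF iso' lift])
  have M: "M i \<in> f i" if "i \<in> \<Sigma>" for i
    using that lift iso unfolding moutard_lift_def isothermic_in_def by blast
  then show "i \<in> \<Sigma> \<Longrightarrow> M i \<in> f i" for i .
  fix i j assume e: "edge \<Sigma> i j"
  have dom: "i \<in> \<Sigma>" "j \<in> \<Sigma>" using edge_in_domain[OF e] by auto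
  have plane: "subspace (f k)" "dim (f k) = 2" if "k \<in> \<Sigma>" for k
    using leg that unfolding legendre_map_def null_planes_def by auto
  obtain \<tau> where \<tau>: "\<And>k. k \<in> \<Sigma> \<Longrightarrow> \<tau> k \<in> Lambda2 (f k)"
    "\<And>k l. edge \<Sigma> k l \<Longrightarrow> \<eta>s l k = \<eta> l k + (\<tau> l - \<tau> k)"
    using iso unfolding isothermic_in_def in_class_def by blast
  have "{wedge21 (\<eta> j i) v | v. v \<in> f j \<inter> f i} \<noteq> {0}"
    using app edge_sym[OF e] unfolding applicable_def by blast
  moreover have "0 \<in> {wedge21 (\<eta> j i) v | v. v \<in> f j \<inter> f i}"
    using subspace_0[OF plane(1)[OF dom(1)]] subspace_0[OF plane(1)[OF dom(2)]]
      wedge21_0_right[of "\<eta> j i"] by force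
  ultimately obtain v where v: "v \<in> f i" "v \<in> f j" "wedge21 (\<eta> j i) v \<noteq> 0" by blast
  have "wedge21 (\<eta>s j i) v = wedge21 (\<eta> j i) v"
    unfolding \<tau>(2)[OF e] wedge21_add wedge21_diff
    using wedge21_Lambda2_plane[OF plane \<tau>(1)] v dom by simp
  then have "wedge21 (wedge (M j) (M i)) v \<noteq> 0"
    using isothermic_moutard_net(3)[OF iso' lift e] v by simp
  then show "M i \<notin> f j"
    using wedge21_Lambda2_plane[OF plane[OF dom(2)] wedge_in_wedge_space v(2)] M[OF dom(2)] by blast
qed

text \<open>The lift on the cylinder comes with the edge-labels, whose definition asserts its existence;
  over the empty domain any maps will do.\<close>

lemma darboux_pair_with_lift:
  assumes "darboux_pair_with B D u \<eta>u v \<eta>v x \<eta>"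
  obtains M H where "moutard_net B (cyl D) (M \<squnion>\<^sub>n H)"
    "moutard_lift D u \<eta>u M" "moutard_lift D v \<eta>v H" "moutard_lift (cyl D) (u \<squnion>\<^sub>n v) \<eta> (M \<squnion>\<^sub>n H)"
    "\<And>i. i \<in> D \<Longrightarrow> x = 1 / ereal (B (M i) (H i))"
proof (cases "D = {}")
  case True
  then have "cyl D = {}" by (auto simp: cyl_def)
  then show ?thesis
    using True that by (auto simp: moutard_net_def moutard_lift_def edge_def quad_def)
next
  case False
  then obtain i0 where i0: "i0 \<in> D" by auto
  have iso: "isothermic B (cyl D) (u \<squnion>\<^sub>n v) \<eta>"
    and eq: "\<And>i j. edge D i j \<Longrightarrow> \<eta> (0 # j) (0 # i) = \<eta>u j i"
      "\<And>i j. edge D i j \<Longrightarrow> \<eta> (1 # j) (1 # i) = \<eta>v j i"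
    and label: "\<And>i. i \<in> D \<Longrightarrow> edge_label B (cyl D) (u \<squnion>\<^sub>n v) \<eta> (0 # i) (1 # i) x"
    using assms unfolding darboux_pair_with_def by blast+
  obtain \<mu> where \<mu>: "moutard_lift (cyl D) (u \<squnion>\<^sub>n v) \<eta> \<mu>"
    using label[OF i0] unfolding edge_label_def by blast
  define M where "M = (\<lambda>i. \<mu> (0 # i))"
  define H where "H = (\<lambda>i. \<mu> (1 # i))"
  have MH: "(M \<squnion>\<^sub>n H) y = \<mu> y" if "y \<in> cyl D" for y
    using that by (auto elim!: in_cylE simp: M_def H_def)
  show thesis
  proof (rule that[of M H])
    show "moutard_net B (cyl D) (M \<squnion>\<^sub>n H)"
      using isothermic_moutard_net(1)[OF iso \<mu>] MH by (rule moutard_net_cong)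
    show "moutard_lift (cyl D) (u \<squnion>\<^sub>n v) \<eta> (M \<squnion>\<^sub>n H)"
      using \<mu> MH by (rule moutard_lift_cong) auto
    have "moutard_lift D u (\<lambda>j i. \<eta> (0 # j) (0 # i)) M"
      using moutard_lift_pullback[OF domain_map_level[of 0] \<mu>] by (simp add: M_def)
    then show "moutard_lift D u \<eta>u M"
      by (rule moutard_lift_cong) (simp_all add: eq)
    have "moutard_lift D v (\<lambda>j i. \<eta> (1 # j) (1 # i)) H"
      using moutard_lift_pullback[OF domain_map_level[of 1] \<mu>] by (simp add: H_def)
    then show "moutard_lift D v \<eta>v H"
      by (rule moutard_lift_cong) (simp_all add: eq)
    show "x = 1 / ereal (B (M i) (H i))" if "i \<in> D" for i
      using label[OF that] edge_label_iff[OF iso \<mu> edge_vertical[OF that]]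
      by (simp add: M_def H_def)
  qed
qed

lemma direct_sum_lines:
  assumes "subspace F" "dim F = 2" "a \<in> F" "b \<in> F" "wedge a b \<noteq> 0"
  shows "direct_sum F (span {a}) (span {b})"
  unfolding direct_sum_def
proof
  show "F = span (span {a} \<union> span {b})"
    using plane_eq_span[OF assms] by (simp add: span_union_lines)
  have "x = 0" if xa: "x \<in> span {a}" and xb: "x \<in> span {b}" for x
  proof -
    obtain p where p: "x = p *\<^sub>R a" using xa unfolding span_singleton by blast
    obtain q where q: "x = q *\<^sub>R b" using xb unfolding span_singleton by blast
    note pq = p q
    have "p *\<^sub>R wedge a b = wedge (p *\<^sub>R a) b" by (simp add: wedge_simps)
    also have "\<dots> = wedge (q *\<^sub>R b) b" using pq by simp
    finally have "p = 0" using assms(5) by (simp add: wedge_simps)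
    then show ?thesis using pq by simp
  qed
  then show "span {a} \<inter> span {b} = {0}" by (auto simp: span_zero)
qed

lemma perp_span: "perp B (span {h}) = {y. B h y = 0}"
  by (auto simp: perp_def span_singleton form_simps)

text \<open>The second plane is the unique null plane that contains \<open>h\<close> and meets \<open>F\<close> nontrivially.\<close>

lemma adjacent_null_plane:
  assumes F: "F \<in> null_planes B" "a \<in> F" and h: "B h h = 0" "B a h \<noteq> 0"
    and k: "k \<in> F" "k \<noteq> 0" "B k h = 0"
  shows "F \<inter> perp B (span {h}) = span {k}"
    and "span (span {h} \<union> span {k}) \<in> null_planes B"
    and "direct_sum (span (span {h} \<union> span {k})) (span {h}) (span {k})"
    and "wedge h k \<noteq> 0"
proof -
  have F': "subspace F" "dim F = 2" "\<And>x y. x \<in> F \<Longrightarrow> y \<in> F \<Longrightarrow> B x y = 0"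
    using F unfolding null_planes_def by auto
  have hk: "B h k = 0" using k(3) sym by simp
  have ka: "wedge k a \<noteq> 0"
  proof
    assume "wedge k a = 0"
    then obtain r where "a = r *\<^sub>R k" using k(2) wedge_eq_0_collinear by blast
    then show False using h k by (simp add: form_simps)
  qed
  have "span {k} \<subseteq> F \<inter> perp B (span {h})"
    unfolding perp_span using F'(1) k(1) hk
    by (auto simp: span_singleton form_simps subspace_scale)
  moreover have "x \<in> span {k}" if "x \<in> F" "B h x = 0" for x
  proof -
    have "x \<in> span {k, a}"
      using that plane_eq_span[OF F'(1,2) k(1) F(2) ka] by simp
    then obtain p q where x: "x - p *\<^sub>R k = q *\<^sub>R a"
      by (auto simp: span_breakdown_eq span_singleton)
    then have "B h (x - p *\<^sub>R k) = q * B a h" using sym[of h a] by (simp add: form_simps)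
    then have "q = 0" using that hk h by (simp add: form_simps)
    then show ?thesis using x by (simp add: span_scale span_base)
  qed
  ultimately show "F \<inter> perp B (span {h}) = span {k}"
    unfolding perp_span by auto
  show hk': "wedge h k \<noteq> 0"
  proof
    assume "wedge h k = 0"
    moreover have "h \<noteq> 0" using h by (auto simp: form_simps)
    ultimately obtain r where r: "k = r *\<^sub>R h" using wedge_eq_0_collinear by blast
    then have "r * B a h = 0" using F'(3)[OF F(2) k(1)] by (simp add: form_simps)
    then show False using r h k(2) by simp
  qed
  have sp: "span (span {h} \<union> span {k}) = span {h, k}"
    by (rule span_union_lines)
  have "h \<noteq> k" using hk' by auto
  moreover have "h \<noteq> 0" using hk' by auto
  then have "independent {k, h}"
    using hk' by (simp add: independent_insert wedge_eq_0_in_span)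
  ultimately have dim: "dim (span {h, k}) = 2"
    using dim_eq_card_independent[of "{k, h}"] by (simp add: insert_commute[of h k])
  have "B x y = 0" if x: "x \<in> span {h, k}" and y: "y \<in> span {h, k}" for x y
  proof -
    obtain p q where x': "x = p *\<^sub>R h + q *\<^sub>R k"
      using x by (rule in_span_pairE)
    obtain p' q' where y': "y = p' *\<^sub>R h + q' *\<^sub>R k"
      using y by (rule in_span_pairE)
    show ?thesis unfolding x' y' using h k hk F'(3)[OF k(1) k(1)] by (simp add: form_simps)
  qed
  then show "span (span {h} \<union> span {k}) \<in> null_planes B"
    unfolding sp null_planes_def using dim by simp
  show "direct_sum (span (span {h} \<union> span {k})) (span {h}) (span {k})"
    using dim hk' unfolding sp by (intro direct_sum_lines) (auto intro: span_base)
qed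

end

section \<open>Darboux transforms with finite parameter\<close>

locale darboux_lift = symmetric_form B for B :: "real^'n \<Rightarrow> real^'n \<Rightarrow> real" +
  fixes D M H and m :: real
  assumes net_cyl: "moutard_net B (cyl D) (M \<squnion>\<^sub>n H)"
    and m: "m \<noteq> 0" and label: "i \<in> D \<Longrightarrow> B (M i) (H i) = 1 / m"
begin

lemma net: "moutard_net B D M"
  using moutard_net_pullback[OF domain_map_level[of 0] net_cyl] by simp

lemma H_null: "i \<in> D \<Longrightarrow> B (H i) (H i) = 0"
  using moutard_net_null[OF net_cyl, of "1 # i"] by simp

lemma vertical_moutard:
  assumes "edge D i j"
  obtains r where "r \<noteq> 0" "H j = M i + r *\<^sub>R (M j - H i)"
proof -
  have "moutard_quad B (M i) (M j) (H j) (H i)"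
    using moutard_net_quad[OF net_cyl quad_vertical[OF assms]] by simp
  then show thesis
    using that moutard_coefficient moutard_net_null[OF net] edge_in_domain[OF assms] by metis
qed

lemma finite_labels_cyl:
  assumes fin: "\<And>i j. edge D i j \<Longrightarrow> B (M i) (M j) \<noteq> 0" and e: "edge (cyl D) x y"
  shows "B ((M \<squnion>\<^sub>n H) x) ((M \<squnion>\<^sub>n H) y) \<noteq> 0"
  using e
proof (cases rule: edge_cyl_cases)
  case (level b i j)
  obtain r where r: "r \<noteq> 0" "H j = M i + r *\<^sub>R (M j - H i)"
    using level(4) by (rule vertical_moutard)
  have "H j = M i + (- r) *\<^sub>R (H i - M j)" using r(2) by (simp add: algebra_simps)
  from opposite_edges[OF this] have "B (M i) (M j) = B (H i) (H j)"
    using r(1) moutard_net_null[OF net] H_null edge_in_domain[OF level(4)] by auto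
  then show ?thesis using level fin by auto
next
  case (up i)
  then show ?thesis using label m by simp
next
  case (down i)
  then show ?thesis using label m sym[of "H i"] by simp
qed

text \<open>A Darboux transform \<open>H\<close> of \<open>M\<close> carries isotropic data along: the linear equation on the vertical
  edges defines \<open>v'\<close>, orthogonality of \<open>v'\<close> and \<open>H\<close> fixes \<open>c'\<close>, and the equation on the edges of the
  upper level is a consequence.\<close>

lemma isotropic_data_cyl:
  assumes data: "isotropic_data B D M v c" and gen: "\<And>i. i \<in> D \<Longrightarrow> B (v i) (H i) \<noteq> 0"
  defines "c' \<equiv> \<lambda>i. m * B (v i) (H i)"
  defines "v' \<equiv> \<lambda>i. c i *\<^sub>R H i + c' i *\<^sub>R M i - v i"
  shows "isotropic_data B (cyl D) (M \<squnion>\<^sub>n H) (v \<squnion>\<^sub>n v') (c \<squnion>\<^sub>n c')"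
proof -
  have d: "B (v i) (v i) = 0" "B (v i) (M i) = 0" "wedge (v i) (M i) \<noteq> 0" "c i \<noteq> 0" if "i \<in> D" for i
    using data that unfolding isotropic_data_def by auto
  have ve: "v i + v j = c j *\<^sub>R M i + c i *\<^sub>R M j" if "edge D i j" for i j
    using data that unfolding isotropic_data_def by auto
  have d': "B (v' i) (v' i) = 0" "B (v' i) (H i) = 0" "wedge (v' i) (H i) \<noteq> 0" "c' i \<noteq> 0"
    if i: "i \<in> D" for i
  proof -
    note * = label[OF i] d[OF i] H_null[OF i] moutard_net_null[OF net i] sym[of "H i" "M i"]
      sym[of "H i" "v i"] sym[of "M i" "v i"] m
    show "B (v' i) (v' i) = 0"
      unfolding v'_def c'_def form_simps using * by simp
    show vH: "B (v' i) (H i) = 0"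
      unfolding v'_def c'_def using * by (simp add: form_simps)
    show "c' i \<noteq> 0" unfolding c'_def using gen[OF i] m by simp
    show "wedge (v' i) (H i) \<noteq> 0"
    proof
      assume "wedge (v' i) (H i) = 0"
      then have "wedge (H i) (v' i) = 0" using wedge_swap[of "H i" "v' i"] by simp
      moreover have "H i \<noteq> 0" using label[OF i] m by (auto simp: form_simps)
      ultimately obtain r where r: "v' i = r *\<^sub>R H i" using wedge_eq_0_collinear by blast
      have "B (M i) (v' i) = c i / m"
        unfolding v'_def using * by (simp add: form_simps)
      then have "r = c i" using r label[OF i] m by (simp add: form_simps)
      then have "v i = c' i *\<^sub>R M i" using r unfolding v'_def by simp
      then show False using d(3)[OF i] by (simp add: wedge_simps)
    qed
  qed
  have ve': "v' i + v' j = c' j *\<^sub>R H i + c' i *\<^sub>R H j" if e: "edge D i j" for i j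
  proof -
    have dom: "i \<in> D" "j \<in> D" using edge_in_domain[OF e] by auto
    obtain r where r: "r \<noteq> 0" "H j = M i + r *\<^sub>R (M j - H i)"
      using e by (rule vertical_moutard)
    have vj: "v j = c j *\<^sub>R M i + c i *\<^sub>R M j - v i" using ve[OF e] by (simp add: eq_diff_eq add.commute)
    have "B (v j) (M j) = c j * B (M i) (M j) - B (v i) (M j)"
      unfolding vj using moutard_net_null[OF net] dom by (simp add: form_simps)
    then have viM: "B (v i) (M j) = c j * B (M i) (M j)" using d dom by simp
    have viH: "B (v i) (H j) = r * (c j * B (M i) (M j) - B (v i) (H i))"
      unfolding r(2) using viM d dom by (simp add: form_simps)
    have MH: "B (M i) (H j) = r * (B (M i) (M j) - 1 / m)"
      unfolding r(2) using label dom moutard_net_null[OF net] by (simp add: form_simps)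
    have "B (v j) (H j) = c j * B (M i) (H j) + c i / m - B (v i) (H j)"
      unfolding vj using label[OF dom(2)] by (simp add: form_simps)
    \<comment> \<open>the relation between \<open>c\<close> and \<open>c'\<close> on the diagonals of the square over the edge\<close>
    then have c'j: "c' j = c i + r * (c' i - c j)"
      unfolding c'_def viH MH using m by (simp add: field_simps)
    show ?thesis
      unfolding v'_def vj r(2) c'j by (simp add: algebra_simps)
  qed
  show ?thesis
    unfolding isotropic_data_def
  proof (intro conjI ballI allI impI)
    fix x assume "x \<in> cyl D"
    then show "B ((v \<squnion>\<^sub>n v') x) ((v \<squnion>\<^sub>n v') x) = 0" "B ((v \<squnion>\<^sub>n v') x) ((M \<squnion>\<^sub>n H) x) = 0"
      "wedge ((v \<squnion>\<^sub>n v') x) ((M \<squnion>\<^sub>n H) x) \<noteq> 0" "(c \<squnion>\<^sub>n c') x \<noteq> 0"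
      by (rule in_cylE; use d d' in force)+
  next
    fix x y assume "edge (cyl D) x y"
    then show "(v \<squnion>\<^sub>n v') x + (v \<squnion>\<^sub>n v') y =
        (c \<squnion>\<^sub>n c') y *\<^sub>R (M \<squnion>\<^sub>n H) x + (c \<squnion>\<^sub>n c') x *\<^sub>R (M \<squnion>\<^sub>n H) y"
    proof (cases rule: edge_cyl_cases)
      case (level b i j)
      then show ?thesis using ve ve' by simp
    qed (simp_all add: v'_def)
  qed
qed

end

locale enveloping_darboux = enveloping B D f M + darboux_lift B D M H m
  for B :: "real^'n \<Rightarrow> real^'n \<Rightarrow> real" and D f M H m
begin

lemma intersection_vector:
  assumes "i \<in> D"
  obtains k where "k \<in> f i" "k \<noteq> 0" "B k (H i) = 0"
proof -
  obtain n where n: "n \<in> f i" "n \<notin> span {M i}"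
    using plane[OF assms] plane_not_in_line by metis
  define k where "k = n - (m * B n (H i)) *\<^sub>R M i"
  have "k \<in> f i"
    unfolding k_def using n plane(1)[OF assms] M_in[OF assms] by (simp add: subspace_diff subspace_scale)
  moreover have "k \<noteq> 0"
    using n(2) unfolding k_def by (auto simp: span_singleton)
  moreover have "B k (H i) = 0"
    unfolding k_def using label[OF assms] m by (simp add: form_simps)
  ultimately show thesis by (rule that)
qed

lemma null_plane: "i \<in> D \<Longrightarrow> f i \<in> null_planes B"
  using legendre unfolding legendre_map_def by simp

lemma hat_map_plane:
  assumes t: "\<And>i. i \<in> D \<Longrightarrow> t i = span {H i}" and i: "i \<in> D"
  shows "hat_map B f t i \<in> null_planes B"
    and "direct_sum (hat_map B f t i) (t i) (f i \<inter> perp B (t i))"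
proof -
  obtain k where k: "k \<in> f i" "k \<noteq> 0" "B k (H i) = 0"
    using i by (rule intersection_vector)
  have "B (M i) (H i) \<noteq> 0" using label[OF i] m by simp
  note * = adjacent_null_plane[OF null_plane[OF i] M_in[OF i] H_null[OF i] this k]
  show "hat_map B f t i \<in> null_planes B"
    "direct_sum (hat_map B f t i) (t i) (f i \<inter> perp B (t i))"
    unfolding hat_map_def t[OF i] *(1) by (rule *)+
qed

lemma hat_map_mem:
  assumes t: "t i = span {H i}" and x: "x \<in> f i" "B x (H i) = 0"
  shows "x + a *\<^sub>R H i \<in> hat_map B f t i"
proof -
  have "x \<in> f i \<inter> perp B (t i)" "H i \<in> t i"
    unfolding t perp_span using x sym[of "H i"] by (auto intro: span_base)
  then show ?thesis
    unfolding hat_map_def by (intro span_add span_scale) (auto intro: span_base)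
qed

text \<open>With \<open>\<sigma>\<close> in \<open>f i \<inter> f j\<close>, the vectors \<open>ki\<close> and \<open>kj\<close> are its projections along \<open>M i\<close> and \<open>M j\<close> to
  the orthogonals of \<open>H i\<close> and \<open>H j\<close>. The Moutard equation on the square over the edge turns
  \<open>ki - kj\<close> into a combination of \<open>H i\<close> and \<open>H j\<close>, which provides a common vector of the new planes.\<close>

lemma legendre_map_hat:
  assumes t: "\<And>i. i \<in> D \<Longrightarrow> t i = span {H i}"
  shows "legendre_map B D (hat_map B f t)"
  unfolding legendre_map_def
proof (intro conjI ballI allI impI hat_map_plane(1) t)
  fix i j assume e: "edge D i j"
  have dom: "i \<in> D" "j \<in> D" using edge_in_domain[OF e] by auto
  obtain r where r: "r \<noteq> 0" "H j = M i + r *\<^sub>R (M j - H i)"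
    using e by (rule vertical_moutard)
  obtain \<sigma> where \<sigma>: "\<sigma> \<noteq> 0" "\<sigma> \<in> f i" "\<sigma> \<in> f j"
    using common_vector[OF e] by metis
  define n where "n = m * B \<sigma> (H i)"
  define ki where "ki = \<sigma> - n *\<^sub>R M i"
  define kj where "kj = \<sigma> + (r * n) *\<^sub>R M j"
  have ki: "ki \<in> f i" "B ki (H i) = 0"
    unfolding ki_def n_def using \<sigma> plane(1) M_in dom label m
    by (simp_all add: subspace_diff subspace_scale form_simps)
  have "B \<sigma> (H j) = - r * B \<sigma> (H i)"
    unfolding r(2) using plane(3) \<sigma> M_in dom by (simp add: form_simps)
  then have kj: "kj \<in> f j" "B kj (H j) = 0"
    unfolding kj_def n_def using \<sigma> plane(1) M_in dom label m
    by (simp_all add: subspace_add subspace_scale form_simps)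
  have eq: "ki + (n * r) *\<^sub>R H i = kj + (- n) *\<^sub>R H j"
    unfolding ki_def kj_def r(2) by (simp add: algebra_simps)
  have "ki + (n * r) *\<^sub>R H i \<in> hat_map B f t i \<inter> hat_map B f t j"
    using hat_map_mem[of t i ki "n * r"] hat_map_mem[of t j kj "- n"] t dom ki kj eq by simp
  moreover have "ki + (n * r) *\<^sub>R H i \<noteq> 0"
  proof
    assume *: "ki + (n * r) *\<^sub>R H i = 0"
    then have "B (M i) (ki + (n * r) *\<^sub>R H i) = 0" by (simp only: form_simps)
    then have "n * r = 0" using plane(3)[OF dom(1) M_in[OF dom(1)] ki(1)] label[OF dom(1)] m
      by (simp add: form_simps)
    then show False using * r(1) \<sigma>(1) unfolding ki_def by simp
  qed
  ultimately show "hat_map B f t i \<inter> hat_map B f t j \<noteq> {0}" by blast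
qed

text \<open>Besides \<open>M\<close> and \<open>H\<close>, the two further nets are \<open>M'\<close> and \<open>H'\<close> from the isotropic data over the
  cylinder. That data arranges the four nets as \<open>(M, H), (M', H')\<close>, and the coordinate exchange
  brings them into the order \<open>(M, M'), (H, H')\<close>.\<close>

lemma legendre_darboux_hat:
  assumes sc: "simply_connected_domain D" and cnt: "countable D"
    and iso: "isothermic_in B D f \<eta> s \<eta>s" and lift: "moutard_lift D s \<eta>s M"
    and noninf: "not_edge_label B D s \<eta>s \<infinity>" and nonm: "not_edge_label B D s \<eta>s (ereal m)"
    and t: "\<And>i. i \<in> D \<Longrightarrow> t i = span {H i}"
    and reg: "legendre_regular D (hat_map B f t)"
  shows "legendre_darboux B D f \<eta> m (hat_map B f t)"
proof -
  have iso': "isothermic B D s \<eta>s" using iso unfolding isothermic_in_def by simp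
  note s = isothermic_moutard_net(2,3)[OF iso' lift]
  have labels: "edge_label B D s \<eta>s i j x \<longleftrightarrow> x = 1 / ereal (B (M i) (M j))" if "edge D i j" for i j x
    using iso' lift that by (rule edge_label_iff)
  have fin: "B (M i) (M j) \<noteq> 0" if "edge D i j" for i j
    using noninf labels[OF that, of \<infinity>] unfolding not_edge_label_def edge_label_infinity by auto
  have H0: "B (M i) (H i) \<noteq> 0" if "i \<in> D" for i using label[OF that] m by simp
  obtain v c where data: "isotropic_data B D M v c" and v_in: "\<And>i. i \<in> D \<Longrightarrow> v i \<in> f i"
    and gen: "\<And>i. i \<in> D \<Longrightarrow> B (v i) (H i) \<noteq> 0"
    using isotropic_data_exists[OF sc cnt fin H0] by metis
  define c' where "c' = (\<lambda>i. m * B (v i) (H i))"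
  define v' where "v' = (\<lambda>i. c i *\<^sub>R H i + c' i *\<^sub>R M i - v i)"
  define M' where "M' = (\<lambda>i. v i /\<^sub>R c i)"
  define H' where "H' = (\<lambda>i. v' i /\<^sub>R c' i)"
  interpret pair: isotropic_pair B D M v c
    using net fin data by unfold_locales
  interpret pair_cyl: isotropic_pair B "cyl D" "M \<squnion>\<^sub>n H" "v \<squnion>\<^sub>n v'" "c \<squnion>\<^sub>n c'"
    using net_cyl finite_labels_cyl[OF fin] isotropic_data_cyl[OF data gen]
    unfolding v'_def c'_def by unfold_locales
  have M'H': "(\<lambda>x. (v \<squnion>\<^sub>n v') x /\<^sub>R (c \<squnion>\<^sub>n c') x) = M' \<squnion>\<^sub>n H'"
    by (auto simp: join_def M'_def H'_def)
  have net4: "moutard_net B (cyl (cyl D)) ((M \<squnion>\<^sub>n M') \<squnion>\<^sub>n (H \<squnion>\<^sub>n H'))"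
    using moutard_net_pullback[OF domain_map_swap2 pair_cyl.moutard_net_cyl]
    by (rule moutard_net_cong) (auto elim!: in_cylE simp: M'H')
  have net_M: "moutard_net B (cyl D) (M \<squnion>\<^sub>n M')"
    using moutard_net_pullback[OF domain_map_level[of 0] net4] by simp
  have net_H: "moutard_net B (cyl D) (H \<squnion>\<^sub>n H')"
    using moutard_net_pullback[OF domain_map_level[of 1] net4] by simp
  have net_M': "moutard_net B D M'"
    using moutard_net_pullback[OF domain_map_level[of 1] net_M] by simp
  define sm where "sm = (\<lambda>i. span {M' i})"
  define tm where "tm = (\<lambda>i. span {H' i})"
  define \<eta>m where "\<eta>m = (\<lambda>j i. wedge (M' j) (M' i))"
  define \<eta>S where "\<eta>S = (\<lambda>y x. wedge ((M \<squnion>\<^sub>n M') y) ((M \<squnion>\<^sub>n M') x))"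
  define \<eta>T where "\<eta>T = (\<lambda>y x. wedge ((H \<squnion>\<^sub>n H') y) ((H \<squnion>\<^sub>n H') x))"
  define \<eta>4 where "\<eta>4 = (\<lambda>y x. wedge (((M \<squnion>\<^sub>n M') \<squnion>\<^sub>n (H \<squnion>\<^sub>n H')) y)
    (((M \<squnion>\<^sub>n M') \<squnion>\<^sub>n (H \<squnion>\<^sub>n H')) x))"
  have iso_m: "isothermic B D sm \<eta>m"
    using net_M' by (rule moutard_net_isothermic(1)) (simp_all add: sm_def \<eta>m_def)
  have lineS: "(s \<squnion>\<^sub>n sm) x = span {(M \<squnion>\<^sub>n M') x}" if "x \<in> cyl D" for x
    using that s(1) by (auto elim!: in_cylE simp: sm_def)
  have lineT: "(t \<squnion>\<^sub>n tm) x = span {(H \<squnion>\<^sub>n H') x}" if "x \<in> cyl D" for x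
    using that t by (auto elim!: in_cylE simp: tm_def)
  have line4: "((s \<squnion>\<^sub>n sm) \<squnion>\<^sub>n (t \<squnion>\<^sub>n tm)) x = span {((M \<squnion>\<^sub>n M') \<squnion>\<^sub>n (H \<squnion>\<^sub>n H')) x}"
    if "x \<in> cyl (cyl D)" for x
    using that lineS lineT by (auto elim!: in_cylE[of x "cyl D"])
  have isoS: "isothermic B (cyl D) (s \<squnion>\<^sub>n sm) \<eta>S" "moutard_lift (cyl D) (s \<squnion>\<^sub>n sm) \<eta>S (M \<squnion>\<^sub>n M')"
    using moutard_net_isothermic[OF net_M lineS] by (simp_all add: \<eta>S_def)
  have isoT: "isothermic B (cyl D) (t \<squnion>\<^sub>n tm) \<eta>T"
    using moutard_net_isothermic[OF net_H lineT] by (simp add: \<eta>T_def)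
  have iso4: "isothermic B (cyl (cyl D)) ((s \<squnion>\<^sub>n sm) \<squnion>\<^sub>n (t \<squnion>\<^sub>n tm)) \<eta>4"
    "moutard_lift (cyl (cyl D)) ((s \<squnion>\<^sub>n sm) \<squnion>\<^sub>n (t \<squnion>\<^sub>n tm)) \<eta>4 ((M \<squnion>\<^sub>n M') \<squnion>\<^sub>n (H \<squnion>\<^sub>n H'))"
    using moutard_net_isothermic[OF net4 line4] by (simp_all add: \<eta>4_def)
  have M'_in: "M' i \<in> f i" if "i \<in> D" for i
    unfolding M'_def using v_in plane(1) that by (simp add: subspace_scale)
  have MM': "B (M i) (M' i) = 0" if "i \<in> D" for i
    using plane(3)[OF that M_in[OF that] M'_in[OF that]] .
  have iso_in: "isothermic_in B D f \<eta> sm \<eta>m"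
    unfolding isothermic_in_def
  proof (intro conjI iso_m ballI)
    show "sm i \<subseteq> f i" if "i \<in> D" for i
      unfolding sm_def using M'_in plane(1) that by (simp add: span_minimal)
    obtain \<tau> where \<tau>: "\<And>k. k \<in> D \<Longrightarrow> \<tau> k \<in> Lambda2 (f k)"
      "\<And>k l. edge D k l \<Longrightarrow> \<eta>s l k = \<eta> l k + (\<tau> l - \<tau> k)"
      using iso unfolding isothermic_in_def in_class_def by blast
    show "in_class D f \<eta> \<eta>m"
      unfolding in_class_def
    proof (intro exI[of _ "\<lambda>i. \<tau> i + wedge (M' i) (M i)"] conjI ballI allI impI)
      fix i assume "i \<in> D"
      then show "\<tau> i + wedge (M' i) (M i) \<in> Lambda2 (f i)"
        using \<tau>(1) wedge_in_wedge_space[OF M'_in M_in]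
        unfolding wedge_space_def by (simp add: span_add)
    next
      fix i j assume e: "edge D i j"
      show "\<eta>m j i = \<eta> j i + (\<tau> j + wedge (M' j) (M j) - (\<tau> i + wedge (M' i) (M i)))"
        using pair.wedge_M'[OF e] \<tau>(2)[OF e] s(2)[OF e]
        unfolding \<eta>m_def M'_def by (simp add: algebra_simps)
    qed
  qed
  have ds: "direct_sum (f i) (s i) (sm i)" if i: "i \<in> D" for i
  proof -
    have "wedge (M i) (M' i) \<noteq> 0"
      using moutard_net_edge[OF net_M edge_vertical[OF i]] wedge_swap[of "M' i" "M i"] by simp
    then show ?thesis
      unfolding s(1)[OF i] sm_def using plane[OF i] M_in[OF i] M'_in[OF i]
      by (intro direct_sum_lines)
  qed
  have dt: "direct_sum (hat_map B f t i) (t i) (tm i)" if i: "i \<in> D" for i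
  proof -
    have "wedge (H i) (H' i) \<noteq> 0"
      using moutard_net_edge[OF net_H edge_vertical[OF i]] wedge_swap[of "H' i" "H i"] by simp
    moreover have "subspace (hat_map B f t i)" "dim (hat_map B f t i) = 2"
      using hat_map_plane(1)[OF t i] unfolding null_planes_def by auto
    moreover have "H i \<in> hat_map B f t i"
      using hat_map_mem[of t i 0 1] t[OF i] subspace_0[OF plane(1)[OF i]] by (simp add: form_simps)
    moreover have "v' i = (c' i *\<^sub>R M i - v i) + c i *\<^sub>R H i" by (simp add: v'_def)
    then have "v' i \<in> hat_map B f t i"
      using hat_map_mem[of t i "c' i *\<^sub>R M i - v i" "c i"] t[OF i] plane(1)[OF i] M_in[OF i]
        v_in[OF i] label[OF i] m
      by (simp add: subspace_diff subspace_scale form_simps c'_def)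
    ultimately show ?thesis
      unfolding t[OF i] tm_def H'_def
      by (intro direct_sum_lines) (auto intro: subspace_scale)
  qed
  have pair_s: "darboux_pair_with B D s \<eta>s sm \<eta>m \<infinity> \<eta>S"
    unfolding darboux_pair_with_def
  proof (intro conjI iso' iso_m isoS(1) allI impI ballI)
    fix i j assume "edge D i j"
    then show "\<eta>S (0 # j) (0 # i) = \<eta>s j i" "\<eta>S (1 # j) (1 # i) = \<eta>m j i"
      by (simp_all add: \<eta>S_def \<eta>m_def s(2))
  next
    fix i assume "i \<in> D"
    then show "edge_label B (cyl D) (s \<squnion>\<^sub>n sm) \<eta>S (0 # i) (1 # i) \<infinity>"
      unfolding edge_label_iff[OF isoS edge_vertical[OF \<open>i \<in> D\<close>]] edge_label_infinity
      by (simp add: MM')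
  qed
  have no_m: "not_edge_label B (cyl D) (s \<squnion>\<^sub>n sm) \<eta>S (ereal m)"
    unfolding not_edge_label_def
  proof (intro allI notI)
    fix x y assume l: "edge_label B (cyl D) (s \<squnion>\<^sub>n sm) \<eta>S x y (ereal m)"
    then have e: "edge (cyl D) x y" unfolding edge_label_def by simp
    have l': "ereal m = 1 / ereal (B ((M \<squnion>\<^sub>n M') x) ((M \<squnion>\<^sub>n M') y))"
      using l edge_label_iff[OF isoS e] by simp
    then have l'': "B ((M \<squnion>\<^sub>n M') x) ((M \<squnion>\<^sub>n M') y) \<noteq> 0"
      unfolding edge_label_inverse[OF m] using m by simp
    show False using e
    proof (cases rule: edge_cyl_cases)
      case (level b i j)
      have "B (M' i) (M' j) = B (M i) (M j)"
        unfolding M'_def using level(4) by (rule pair.form_M')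
      then have "edge_label B D s \<eta>s i j (ereal m)"
        unfolding labels[OF level(4)] using l' level by auto
      then show False using nonm unfolding not_edge_label_def by blast
    next
      case (up i)
      then show False using l'' MM' by simp
    next
      case (down i)
      then show False using l'' MM' sym[of "M' i"] by simp
    qed
  qed
  have pair_t: "darboux_pair B (cyl D) (s \<squnion>\<^sub>n sm) \<eta>S (t \<squnion>\<^sub>n tm) \<eta>T (ereal m)"
    unfolding darboux_pair_def darboux_pair_with_def
  proof (intro exI[of _ \<eta>4] conjI isoS(1) isoT iso4(1) allI impI ballI)
    fix x y
    show "\<eta>4 (0 # y) (0 # x) = \<eta>S y x" "\<eta>4 (1 # y) (1 # x) = \<eta>T y x"
      by (simp_all add: \<eta>4_def \<eta>S_def \<eta>T_def)
  next
    fix x assume x: "x \<in> cyl D"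
    then obtain b i where bi: "x = b # i" "b \<in> {0, 1}" "i \<in> D" by (rule in_cylE)
    have "B (M' i) (H' i) = 1 / m"
      using pair_cyl.form_M'[OF edge_vertical[OF bi(3)]] label[OF bi(3)]
      unfolding M'_def H'_def by simp
    then have "B ((M \<squnion>\<^sub>n M') x) ((H \<squnion>\<^sub>n H') x) = 1 / m"
      using bi label by auto
    then show "edge_label B (cyl (cyl D)) ((s \<squnion>\<^sub>n sm) \<squnion>\<^sub>n (t \<squnion>\<^sub>n tm)) \<eta>4 (0 # x) (1 # x) (ereal m)"
      unfolding edge_label_iff[OF iso4 edge_vertical[OF x]] using m by (simp add: one_ereal_def)
  qed
  show ?thesis
    unfolding legendre_darboux_def
    using m legendre_map_hat[OF t] reg iso iso_in ds pair_s no_m pair_t dt by blast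
qed

end

context symmetric_form
begin

text \<open>The square of nets over \<open>{0,1}\<^sup>2\<close> restricts to its side from \<open>sp\<close> to \<open>tp\<close>.\<close>

lemma darboux_pair_restrict:
  assumes "darboux_pair B (cyl D) (sp \<squnion>\<^sub>n sm) \<eta>s (tp \<squnion>\<^sub>n tm) \<eta>t x"
    and p: "isothermic B D sp \<eta>p" and \<eta>p: "\<And>i j. edge D i j \<Longrightarrow> \<eta>s (0 # j) (0 # i) = \<eta>p j i"
  shows "darboux_pair B D sp \<eta>p tp (\<lambda>j i. \<eta>t (0 # j) (0 # i)) x"
proof -
  obtain \<eta> where d: "isothermic B (cyl D) (tp \<squnion>\<^sub>n tm) \<eta>t"
    "isothermic B (cyl (cyl D)) ((sp \<squnion>\<^sub>n sm) \<squnion>\<^sub>n (tp \<squnion>\<^sub>n tm)) \<eta>"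
    "\<And>y z. edge (cyl D) y z \<Longrightarrow> \<eta> (0 # z) (0 # y) = \<eta>s z y \<and> \<eta> (1 # z) (1 # y) = \<eta>t z y"
    "\<And>y. y \<in> cyl D \<Longrightarrow>
      edge_label B (cyl (cyl D)) ((sp \<squnion>\<^sub>n sm) \<squnion>\<^sub>n (tp \<squnion>\<^sub>n tm)) \<eta> (0 # y) (1 # y) x"
    using assms(1) unfolding darboux_pair_def darboux_pair_with_def by blast
  define \<phi> :: "int list \<Rightarrow> int list" where "\<phi> = (\<lambda>y. hd y # 0 # tl y)"
  have "domain_map (cyl D) (cyl (cyl D)) (swap2 \<circ> (#) 0)"
    using domain_map_comp[OF domain_map_level domain_map_swap2] by simp
  then have \<phi>: "domain_map (cyl D) (cyl (cyl D)) \<phi>"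
    by (rule domain_map_cong) (auto elim!: in_cylE simp: \<phi>_def)
  have sptp: "(\<lambda>y. ((sp \<squnion>\<^sub>n sm) \<squnion>\<^sub>n (tp \<squnion>\<^sub>n tm)) (\<phi> y)) = sp \<squnion>\<^sub>n tp"
    by (rule ext) (simp add: \<phi>_def join_def)
  show ?thesis
    unfolding darboux_pair_def darboux_pair_with_def
  proof (intro exI[of _ "\<lambda>z y. \<eta> (\<phi> z) (\<phi> y)"] conjI p allI impI ballI)
    show "isothermic B D tp (\<lambda>j i. \<eta>t (0 # j) (0 # i))"
      using isothermic_pullback[OF domain_map_level[of 0] d(1)] by simp
    show "isothermic B (cyl D) (sp \<squnion>\<^sub>n tp) (\<lambda>z y. \<eta> (\<phi> z) (\<phi> y))"
      using isothermic_pullback[OF \<phi> d(2)] unfolding sptp .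
  next
    fix i j assume e: "edge D i j"
    have e0: "edge (cyl D) (0 # i) (0 # j)" using e by (simp add: edge_Cons_level)
    show "\<eta> (\<phi> (0 # j)) (\<phi> (0 # i)) = \<eta>p j i"
      "\<eta> (\<phi> (1 # j)) (\<phi> (1 # i)) = \<eta>t (0 # j) (0 # i)"
      using d(3)[OF e0] \<eta>p[OF e] by (simp_all add: \<phi>_def)
  next
    fix i assume i: "i \<in> D"
    then obtain \<mu> where \<mu>: "moutard_lift (cyl (cyl D)) ((sp \<squnion>\<^sub>n sm) \<squnion>\<^sub>n (tp \<squnion>\<^sub>n tm)) \<eta> \<mu>"
      "x = 1 / ereal (B (\<mu> (0 # 0 # i)) (\<mu> (1 # 0 # i)))"
      using d(4)[of "0 # i"] unfolding edge_label_def by auto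
    have "moutard_lift (cyl D) (sp \<squnion>\<^sub>n tp) (\<lambda>z y. \<eta> (\<phi> z) (\<phi> y)) (\<lambda>y. \<mu> (\<phi> y))"
      using moutard_lift_pullback[OF \<phi> \<mu>(1)] unfolding sptp .
    then show "edge_label B (cyl D) (sp \<squnion>\<^sub>n tp) (\<lambda>z y. \<eta> (\<phi> z) (\<phi> y)) (0 # i) (1 # i) x"
      unfolding edge_label_def using \<mu>(2) edge_vertical[OF i]
      by (intro conjI exI[of _ "\<lambda>y. \<mu> (\<phi> y)"]) (auto simp: \<phi>_def)
  qed
qed

text \<open>On the square over \<open>i\<close> the Moutard equation says that \<open>K0 + r K1 = L1 + r L0\<close>, where \<open>K\<close> lifts
  the two lines in \<open>f i\<close> and \<open>L\<close> those in \<open>g i\<close>. This is a nonzero vector of \<open>f i \<inter> g i\<close>; being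
  orthogonal to \<open>tp i\<close>, it spans \<open>f i \<inter> perp B (tp i)\<close>.\<close>

lemma hat_map_of_darboux_pair:
  assumes pair: "darboux_pair B (cyl D) (sp \<squnion>\<^sub>n sm) \<eta>s (tp \<squnion>\<^sub>n tm) \<eta>t (ereal m)" and m: "m \<noteq> 0"
    and i: "i \<in> D" and f: "f i \<in> null_planes B" "sp i \<subseteq> f i" "sm i \<subseteq> f i"
    and g: "g i \<in> null_planes B" "tp i \<subseteq> g i" "tm i \<subseteq> g i"
  shows "g i = hat_map B f tp i" "direct_sum (g i) (tp i) (f i \<inter> perp B (tp i))"
proof -
  obtain \<eta> where \<eta>: "darboux_pair_with B (cyl D) (sp \<squnion>\<^sub>n sm) \<eta>s (tp \<squnion>\<^sub>n tm) \<eta>t (ereal m) \<eta>"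
    using pair unfolding darboux_pair_def by blast
  then have isoT: "isothermic B (cyl D) (tp \<squnion>\<^sub>n tm) \<eta>t"
    unfolding darboux_pair_with_def by simp
  obtain K L where net: "moutard_net B (cyl (cyl D)) (K \<squnion>\<^sub>n L)"
    and K: "moutard_lift (cyl D) (sp \<squnion>\<^sub>n sm) \<eta>s K" and L: "moutard_lift (cyl D) (tp \<squnion>\<^sub>n tm) \<eta>t L"
    and lab: "\<And>y. y \<in> cyl D \<Longrightarrow> ereal m = 1 / ereal (B (K y) (L y))"
    using darboux_pair_with_lift[OF \<eta>] by metis
  have "B (K y) (L y) = 1 / m" if "y \<in> cyl D" for y
    using lab[OF that] unfolding edge_label_inverse[OF m] .
  then interpret darboux_lift B "cyl D" K L m
    using net m by unfold_locales
  have mem: "K (0 # i) \<in> sp i" "K (1 # i) \<in> sm i" "L (0 # i) \<in> tp i" "L (1 # i) \<in> tm i"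
    using K[unfolded moutard_lift_def, THEN conjunct1, rule_format, of "0 # i"]
      K[unfolded moutard_lift_def, THEN conjunct1, rule_format, of "1 # i"]
      L[unfolded moutard_lift_def, THEN conjunct1, rule_format, of "0 # i"]
      L[unfolded moutard_lift_def, THEN conjunct1, rule_format, of "1 # i"] i by simp_all
  have tp: "tp i = span {L (0 # i)}"
    using isothermic_moutard_net(2)[OF isoT L, of "0 # i"] i by simp
  have F: "subspace (f i)" and G: "subspace (g i)" "dim (g i) = 2"
    "\<And>x y. x \<in> g i \<Longrightarrow> y \<in> g i \<Longrightarrow> B x y = 0"
    using f g unfolding null_planes_def by auto
  obtain r where r: "L (1 # i) = K (0 # i) + r *\<^sub>R (K (1 # i) - L (0 # i))"
    using vertical_moutard[OF edge_vertical[OF i]] by metis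
  define k where "k = K (0 # i) + r *\<^sub>R K (1 # i)"
  have k': "k = L (1 # i) + r *\<^sub>R L (0 # i)"
    unfolding k_def r by (simp add: algebra_simps)
  have kf: "k \<in> f i"
    unfolding k_def using mem f F by (auto intro!: subspace_add subspace_scale)
  have kg: "k \<in> g i"
    unfolding k' using mem g G by (auto intro!: subspace_add subspace_scale)
  have k0: "k \<noteq> 0"
  proof
    assume "k = 0"
    then have "wedge (K (1 # i)) k = 0" by simp
    then show False
      using moutard_net_edge[OF darboux_lift.net[OF darboux_lift_axioms] edge_vertical[OF i]]
      unfolding k_def by (simp add: wedge_simps)
  qed
  have KL: "B (K (0 # i)) (L (0 # i)) \<noteq> 0" using label[of "0 # i"] i m by simp
  have "B k (L (0 # i)) = 0" using G(3)[OF kg] mem(3) g(2) by auto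
  note * = adjacent_null_plane[OF f(1) subsetD[OF f(2) mem(1)] H_null[of "0 # i"]
      KL kf k0 this]
  have "g i = span {L (0 # i), k}"
    using G mem(3) g(2) kg *(4) i by (intro plane_eq_span) auto
  also have "\<dots> = span (span {L (0 # i)} \<union> span {k})"
    by (rule span_union_lines[symmetric])
  finally have gi: "g i = span (span {L (0 # i)} \<union> span {k})" .
  show "g i = hat_map B f tp i" "direct_sum (g i) (tp i) (f i \<inter> perp B (tp i))"
    unfolding hat_map_def tp using * gi i by simp_all
qed

text \<open>If \<open>M i\<close> were orthogonal to \<open>M j\<close>, it would be orthogonal to all of \<open>f j\<close>, hence to \<open>sm j\<close>. But these
  two lines are opposite on the square over the edge.\<close>

lemma not_infinite_label:
  assumes app: "applicable B D f \<eta>" and p: "isothermic_in B D f \<eta> sp \<eta>p"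
    and sm: "\<And>i. i \<in> D \<Longrightarrow> sm i \<subseteq> f i"
    and pair: "darboux_pair_with B D sp \<eta>p sm \<eta>m x \<eta>s"
  shows "not_edge_label B D sp \<eta>p \<infinity>"
  unfolding not_edge_label_def
proof (intro allI notI)
  fix i j assume l: "edge_label B D sp \<eta>p i j \<infinity>"
  then have e: "edge D i j" unfolding edge_label_def by simp
  obtain M H where net_cyl: "moutard_net B (cyl D) (M \<squnion>\<^sub>n H)"
    and M: "moutard_lift D sp \<eta>p M" and H: "moutard_lift D sm \<eta>m H"
    using darboux_pair_with_lift[OF pair] by metis
  interpret enveloping B D f M
    using app p M by (rule enveloping_isothermic_in)
  have dom: "i \<in> D" "j \<in> D" using edge_in_domain[OF e] by auto
  have "B (M i) (M j) = 0"
    using l edge_label_iff[OF _ M e] p edge_label_infinity unfolding isothermic_in_def by simp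
  moreover obtain \<sigma> where \<sigma>: "\<sigma> \<in> f i" "f j = span {M j, \<sigma>}"
    using common_vector[OF e] by metis
  moreover have "H j \<in> span {M j, \<sigma>}"
    using H sm[OF dom(2)] dom \<sigma>(2) unfolding moutard_lift_def by auto
  then obtain p q where "H j = p *\<^sub>R M j + q *\<^sub>R \<sigma>"
    by (rule in_span_pairE)
  ultimately have "B (M i) (H j) = 0"
    using plane(3)[OF dom(1) M_in[OF dom(1)] \<sigma>(1)] by (simp add: form_simps)
  then show False
    using moutard_net_quad[OF net_cyl quad_vertical[OF e]] by (simp add: moutard_quad_def)
qed

end

section \<open>Darboux transforms of applicable Legendre maps\<close>

theorem proposition5p4:
  fixes B :: "real^'n \<Rightarrow> real^'n \<Rightarrow> real"
    and p q N :: nat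
    and \<Sigma> :: "int list set"
    and f :: "int list \<Rightarrow> (real^'n) set"
    and \<eta> :: "int list \<Rightarrow> int list \<Rightarrow> real^'n^'n"
    and m :: real
  assumes "p \<ge> 1" and "q \<ge> 1"
    and "has_signature B (p + 1) (q + 1)"
    and "\<Sigma> \<subseteq> lattice N"
    and "simply_connected_domain \<Sigma>"
    and "applicable B \<Sigma> f \<eta>"
    and "m \<noteq> 0"
  shows "(\<forall>s \<eta>s t \<eta>t.
            isothermic_in B \<Sigma> f \<eta> s \<eta>s \<and>
            not_edge_label B \<Sigma> s \<eta>s \<infinity> \<and>
            not_edge_label B \<Sigma> s \<eta>s (ereal m) \<and>
            darboux_pair B \<Sigma> s \<eta>s t \<eta>t (ereal m)
            \<longrightarrow> (\<forall>i\<in>\<Sigma>. direct_sum (hat_map B f t i) (t i) (f i \<inter> perp B (t i))) \<and>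
                legendre_map B \<Sigma> (hat_map B f t) \<and>
                (legendre_regular \<Sigma> (hat_map B f t)
                   \<longrightarrow> legendre_darboux B \<Sigma> f \<eta> m (hat_map B f t))) \<and>
         (\<forall>g. legendre_darboux B \<Sigma> f \<eta> m g
            \<longrightarrow> (\<exists>s \<eta>s t \<eta>t.
                  isothermic_in B \<Sigma> f \<eta> s \<eta>s \<and>
                  not_edge_label B \<Sigma> s \<eta>s \<infinity> \<and>
                  not_edge_label B \<Sigma> s \<eta>s (ereal m) \<and>
                  darboux_pair B \<Sigma> s \<eta>s t \<eta>t (ereal m) \<and>
                  (\<forall>i\<in>\<Sigma>. g i = hat_map B f t i \<and>
                     direct_sum (g i) (t i) (f i \<inter> perp B (t i)))))"
proof -
  interpret symmetric_form B
    using assms(3) unfolding has_signature_def by unfold_locales auto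
  note sc = assms(5) and app = assms(6) and m = assms(7)
  have cnt: "countable \<Sigma>" by simp
  have f: "f i \<in> null_planes B" if "i \<in> \<Sigma>" for i
    using app that unfolding applicable_def legendre_map_def by simp
  show ?thesis
  proof (intro conjI[rotated] allI impI)
    fix g assume g: "legendre_darboux B \<Sigma> f \<eta> m g"
    obtain sp \<eta>p sm \<eta>m \<eta>s tp tm \<eta>t where
      sp: "isothermic_in B \<Sigma> f \<eta> sp \<eta>p" and sm: "isothermic_in B \<Sigma> f \<eta> sm \<eta>m"
      and pair_s: "darboux_pair_with B \<Sigma> sp \<eta>p sm \<eta>m \<infinity> \<eta>s"
      and nm: "not_edge_label B (cyl \<Sigma>) (sp \<squnion>\<^sub>n sm) \<eta>s (ereal m)"
      and pair: "darboux_pair B (cyl \<Sigma>) (sp \<squnion>\<^sub>n sm) \<eta>s (tp \<squnion>\<^sub>n tm) \<eta>t (ereal m)"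
      and ds: "\<And>i. i \<in> \<Sigma> \<Longrightarrow> direct_sum (g i) (tp i) (tm i)"
      using g unfolding legendre_darboux_def by blast
    have gn: "g i \<in> null_planes B" if "i \<in> \<Sigma>" for i
      using g that unfolding legendre_darboux_def legendre_map_def by simp
    have iso_p: "isothermic B \<Sigma> sp \<eta>p" using sp unfolding isothermic_in_def by simp
    have sub: "sp i \<subseteq> f i" "sm i \<subseteq> f i" "tp i \<subseteq> g i" "tm i \<subseteq> g i" if "i \<in> \<Sigma>" for i
      using sp sm ds[OF that] that span_superset[of "tp i \<union> tm i"]
      unfolding isothermic_in_def direct_sum_def by simp_all
    have "not_edge_label B \<Sigma> sp \<eta>p \<infinity>"
      using app sp sub(2) pair_s by (rule not_infinite_label)
    moreover have "not_edge_label B \<Sigma> sp \<eta>p (ereal m)"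
      unfolding not_edge_label_def
    proof (intro allI notI)
      fix i j assume l: "edge_label B \<Sigma> sp \<eta>p i j (ereal m)"
      then have e: "edge \<Sigma> i j" unfolding edge_label_def by simp
      obtain M H where M: "moutard_lift \<Sigma> sp \<eta>p M"
        and MH: "moutard_lift (cyl \<Sigma>) (sp \<squnion>\<^sub>n sm) \<eta>s (M \<squnion>\<^sub>n H)"
        using darboux_pair_with_lift[OF pair_s] by metis
      have "isothermic B (cyl \<Sigma>) (sp \<squnion>\<^sub>n sm) \<eta>s" "edge (cyl \<Sigma>) (0 # i) (0 # j)"
        using pair_s e unfolding darboux_pair_with_def by (auto simp: edge_Cons_level)
      note edge_label_iff[OF this(1) MH this(2), of "ereal m"]
      then show False
        using l edge_label_iff[OF iso_p M e] nm unfolding not_edge_label_def by simp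
    qed
    moreover have "darboux_pair B \<Sigma> sp \<eta>p tp (\<lambda>j i. \<eta>t (0 # j) (0 # i)) (ereal m)"
    proof (rule darboux_pair_restrict[OF pair iso_p])
      show "\<eta>s (0 # j) (0 # i) = \<eta>p j i" if "edge \<Sigma> i j" for i j
        using pair_s that unfolding darboux_pair_with_def by blast
    qed
    moreover have "\<forall>i\<in>\<Sigma>. g i = hat_map B f tp i \<and> direct_sum (g i) (tp i) (f i \<inter> perp B (tp i))"
    proof
      fix i assume i: "i \<in> \<Sigma>"
      note * = hat_map_of_darboux_pair[where f = f and g = g and i = i, OF pair m i f[OF i] sub(1,2)[OF i] gn[OF i] sub(3,4)[OF i]]
      show "g i = hat_map B f tp i \<and> direct_sum (g i) (tp i) (f i \<inter> perp B (tp i))"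
        using * by (rule conjI)
    qed
    ultimately show "\<exists>s \<eta>s t \<eta>t.
        isothermic_in B \<Sigma> f \<eta> s \<eta>s \<and> not_edge_label B \<Sigma> s \<eta>s \<infinity> \<and>
        not_edge_label B \<Sigma> s \<eta>s (ereal m) \<and> darboux_pair B \<Sigma> s \<eta>s t \<eta>t (ereal m) \<and>
        (\<forall>i\<in>\<Sigma>. g i = hat_map B f t i \<and> direct_sum (g i) (t i) (f i \<inter> perp B (t i)))"
      using sp by blast
  next
    fix s \<eta>s t \<eta>t
    assume *: "isothermic_in B \<Sigma> f \<eta> s \<eta>s \<and> not_edge_label B \<Sigma> s \<eta>s \<infinity> \<and>
      not_edge_label B \<Sigma> s \<eta>s (ereal m) \<and> darboux_pair B \<Sigma> s \<eta>s t \<eta>t (ereal m)"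
    then obtain \<eta>2 where \<eta>2: "darboux_pair_with B \<Sigma> s \<eta>s t \<eta>t (ereal m) \<eta>2"
      unfolding darboux_pair_def by blast
    then have iso_t: "isothermic B \<Sigma> t \<eta>t" unfolding darboux_pair_with_def by simp
    obtain M H where net_cyl: "moutard_net B (cyl \<Sigma>) (M \<squnion>\<^sub>n H)"
      and M: "moutard_lift \<Sigma> s \<eta>s M" and H: "moutard_lift \<Sigma> t \<eta>t H"
      and lab: "\<And>i. i \<in> \<Sigma> \<Longrightarrow> ereal m = 1 / ereal (B (M i) (H i))"
      using darboux_pair_with_lift[OF \<eta>2] by metis
    interpret enveloping B \<Sigma> f M
      using app conjunct1[OF *] M by (rule enveloping_isothermic_in)
    have "B (M i) (H i) = 1 / m" if "i \<in> \<Sigma>" for i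
      using lab[OF that] unfolding edge_label_inverse[OF m] .
    then interpret enveloping_darboux B \<Sigma> f M H m
      using net_cyl m by unfold_locales
    have t: "t i = span {H i}" if "i \<in> \<Sigma>" for i
      using isothermic_moutard_net(2)[OF iso_t H that] .
    show "\<forall>i\<in>\<Sigma>. direct_sum (hat_map B f t i) (t i) (f i \<inter> perp B (t i))"
      using hat_map_plane(2)[OF t] by blast
    show "legendre_map B \<Sigma> (hat_map B f t)"
      using t by (rule legendre_map_hat)
    show "legendre_darboux B \<Sigma> f \<eta> m (hat_map B f t)" if "legendre_regular \<Sigma> (hat_map B f t)"
      using legendre_darboux_hat[OF sc cnt _ M _ _ t that] * by blast
  qed
qed

end
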